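(* Consider the CD-GraB algorithm (defined in the context) run for $T$ epochs with $m$ workers, $n$ examples per worker, from arbitrary initial weights $w_1$ and arbitrary initial permutations. Suppose that: (1) (Bounded gradient variance) there is $\sigma>0$ with $\|\nabla f^i(w;j)-\nabla f^i(w)\|_2^2\le\sigma^2$ for all $i\in[m]$, $j\in[n]$, $w\in\mathbb{R}^d$; (2) (Bounded data heterogeneity) there is $\varsigma>0$ with $\|\nabla f^i(w)-\nabla f(w)\|_2^2\le\varsigma^2$ for all $i\in[m]$, $w\in\mathbb{R}^d$; (3) (Smoothness) there is $L_{2,\infty}>0$ with $\|\nabla f^i(w;j)-\nabla f^i(v;j)\|_2\le L_{2,\infty}\|w-v\|_\infty$ for all $w,v\in\mathbb{R}^d$, $i\in[m]$, $j\in[n]$; (4) (P.L. condition) there is $\mu>0$ with $\frac12\|\nabla f(w)\|_2^2\ge\mu\,(f(w)-\inf_{v\in\mathbb{R}^d}f(v))$ for all $w\in\mathbb{R}^d$. Let $\delta>0$, let $F_t=f(w_t)-\inf_{w\in\mathbb{R}^d}f(w)$, let $\tilde A=\sqrt{2\log(4d/\delta)\log(4N/\delta)}$ with $N=mn$, and set $$C_3=\frac{(F_1+\sigma^2/L_{2,\infty})\mu^2}{224L_{2,\infty}^2(\varsigma+\sigma)^2\tilde A^2},\qquad \tilde W=W_0(T^2m^2n^2C_3),$$ where $W_0$ is the (principal branch of the) Lambert-W function. If the learning rate is $\alpha=\frac{2\tilde W}{Tn\mu}$ and the number of epochs satisfies $$T\ge10+\frac1\mu\,32L_{2,\infty}\bigl(2+\tilde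 A/(mn)\bigr)W_0\bigl((mnT)^2C_3\bigr),$$ then, with probability at least $1-T\delta$, $$F_{T+1}\le\frac{1}{(mnT)^2}\left(\frac{(F_1+\sigma^2/L_{2,\infty})\tilde W}{C_3}+\frac{112L_{2,\infty}^2(\varsigma+\sigma)^2\tilde A^2\tilde W^2}{\mu^3}\right),$$ so that the right-hand side is $\tilde O\left(\frac{1}{(mnT)^2}\right)$, where $\tilde O$ hides logarithmic factors in the problem parameters.
   Context: Setting. There are $m$ workers, each holding $n$ local examples, $n$ even, $N=mn$. $f^i(\cdot;j):\mathbb{R}^d\to\mathbb{R}$ is the differentiable loss of the $j$-th example of worker $i$; $f^i(w)=\frac1n\sum_{j=1}^n f^i(w;j)$ and $f(w)=\frac1m\sum_{i=1}^m f^i(w)$. $f$ is assumed bounded below. Model updates. In epoch $t$ worker $i$ uses a permutation $\pi_{t,i}:[n]\to[n]$ of its local examples, and $$w_t^{j+1}=w_t^j-\frac{\alpha}{m}\sum_{i=1}^m\nabla f^i(w_t^j;\pi_{t,i}(j)),\qquad j\in[n],$$ with $w_t:=w_t^1$ and $w_{t+1}:=w_{t+1}^1:=w_t^{n+1}$. CD-GraB ordering. The permutations $\pi_{t+1,i}$ are computed from the gradients $g_j^i=\nabla f^i(w_t^j;\pi_{t,i}(j))$ of epoch $t$ as follows. Start with running sum $r=0$. For $k=1,\dots,n/2$ and, for each $k$, for $i=1,\dots,m$ in order: feed the pair difference $c=g_{2k-1}^i-g_{2k}^i$ to a subroutine RandomizedBalance$(r,c)$, which draws a random sign $s\in\{+1,-1\}$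 and updates $r\leftarrow r+sc$; assign sign $s$ to position $2k-1$ and sign $-s$ to position $2k$ of worker $i$. Afterwards, for each worker $i$, let $L_{\rm pos}$ (resp. $L_{\rm neg}$) be the list of examples $\pi_{t,i}(j)$, in increasing order of $j$, whose position $j$ got sign $+1$ (resp. $-1$); $\pi_{t+1,i}$ is the concatenation of $L_{\rm pos}$ and the reverse of $L_{\rm neg}$. Fresh randomness is used in every epoch. RandomizedBalance. This is the self-balancing random walk (sign $+1$ drawn with probability $\frac12-\frac{\langle r,c\rangle}{2w}$ for a suitable normalization/threshold $w$, else $-1$), run with failure parameter $\delta$. Its known guarantee (Dwivedi–Mackey, Kernel thinning, Corollary 7) is taken as given: for any vectors $c_1,\dots,c_K\in\mathbb{R}^d$, $K\le N$, fixed independently of the signs, fed in sequence starting from $r=0$, with probability at least $1-\delta$ the output signs satisfy $\max_{k\in[K]}\|\sum_{j=1}^k s_jc_j\|_\infty\le\tilde A\,\max_j\|c_j\|_2$, where $\tilde A=\sqrt{2\log(4d/\delta)\log(4N/\delta)}$. *)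

theory Defs
  imports
    "HOL-Probability.Probability"
    "HOL-Combinatorics.Multiset_Permutations"
    "HOL-Library.Landau_Symbols"
begin

text \<open>
  Workers, local examples and positions within an epoch are numbered from 0: workers are
  \<open>i < m\<close>, examples and positions are \<open>j < n\<close>, and \<open>loss i j\<close> is the loss of example \<open>j\<close> of
  worker \<open>i\<close>.  A permutation of the examples of worker \<open>i\<close> is the list of examples in the order
  of their use, i.e. an element of \<open>permutations_of_set {..<n}\<close>.
\<close>

definition grad :: "('a::real_inner \<Rightarrow> real) \<Rightarrow> 'a \<Rightarrow> 'a" where
  "grad f x = (THE D. GDERIV f x :> D)"

definition local_loss ::
  "nat \<Rightarrow> (nat \<Rightarrow> nat \<Rightarrow> 'a \<Rightarrow> real) \<Rightarrow> nat \<Rightarrow> 'a \<Rightarrow> real" where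
  "local_loss n loss i w = (\<Sum>j<n. loss i j w) / real n"

definition global_loss ::
  "nat \<Rightarrow> nat \<Rightarrow> (nat \<Rightarrow> nat \<Rightarrow> 'a \<Rightarrow> real) \<Rightarrow> 'a \<Rightarrow> real" where
  "global_loss m n loss w = (\<Sum>i<m. local_loss n loss i w) / real m"

subsection \<open>Randomized balancing\<close>

text \<open>Signs are Booleans, \<open>True\<close> standing for \<open>+1\<close>.\<close>

definition sign_val :: "bool \<Rightarrow> real" where
  "sign_val s = (if s then 1 else - 1)"

text \<open>
  One call with running sum \<open>r\<close>, input \<open>c\<close> and threshold \<open>h\<close>.  Note that \<open>bernoulli_pmf\<close> clamps
  its argument to the unit interval.
\<close>

definition randomized_balance :: "real \<Rightarrow> 'a::real_inner \<Rightarrow> 'a \<Rightarrow> bool pmf" where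
  "randomized_balance h r c = bernoulli_pmf (1 / 2 - inner r c / (2 * h))"

text \<open>
  The signs drawn when a list of vectors is fed in sequence.  The threshold of a call is given by
  a rule \<open>thr\<close> applied to the list of all vectors fed so far, the current one included; this
  covers both constant and adaptive thresholds.  The arguments \<open>hist\<close> and \<open>r\<close> are the vectors
  already fed and the current running sum.
\<close>

fun balance_walk ::
  "('a::real_inner list \<Rightarrow> real) \<Rightarrow> 'a list \<Rightarrow> 'a \<Rightarrow> 'a list \<Rightarrow> bool list pmf" where
  "balance_walk thr hist r [] = return_pmf []"
| "balance_walk thr hist r (c # cs) =
     bind_pmf (randomized_balance (thr (hist @ [c])) r c)
       (\<lambda>s. map_pmf ((#) s)
              (balance_walk thr (hist @ [c]) (r + sign_val s *\<^sub>R c) cs))"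

definition balance_const :: "nat \<Rightarrow> nat \<Rightarrow> real \<Rightarrow> real" where
  "balance_const d N \<delta> = sqrt (2 * ln (4 * real d / \<delta>) * ln (4 * real N / \<delta>))"

definition balance_guarantee ::
  "((real ^ 'd) list \<Rightarrow> real) \<Rightarrow> nat \<Rightarrow> real \<Rightarrow> bool" where
  "balance_guarantee thr N \<delta> \<longleftrightarrow>
     (\<forall>cs. length cs \<le> N \<longrightarrow>
        measure_pmf.prob (balance_walk thr [] 0 cs)
          {ss. \<forall>k\<in>{1..length cs}.
             infnorm (\<Sum>j<k. sign_val (ss ! j) *\<^sub>R cs ! j)
               \<le> balance_const CARD('d) N \<delta> * Max (norm ` set cs)}
        \<ge> 1 - \<delta>)"

subsection \<open>The CD-GraB algorithm\<close>

text \<open>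
  \<open>inner_iterate m loss \<alpha> w \<pi> j\<close> is the weight vector after the first \<open>j\<close> steps of an epoch started
  at \<open>w\<close> with orders \<open>\<pi>\<close>; position \<open>j\<close> uses the gradients at this point.
\<close>

primrec inner_iterate ::
  "nat \<Rightarrow> (nat \<Rightarrow> nat \<Rightarrow> 'a::real_inner \<Rightarrow> real) \<Rightarrow> real \<Rightarrow> 'a \<Rightarrow> (nat \<Rightarrow> nat list) \<Rightarrow> nat \<Rightarrow> 'a" where
  "inner_iterate m loss \<alpha> w \<pi> 0 = w"
| "inner_iterate m loss \<alpha> w \<pi> (Suc j) =
     inner_iterate m loss \<alpha> w \<pi> j
     - (\<alpha> / real m) *\<^sub>R (\<Sum>i<m. grad (loss i (\<pi> i ! j)) (inner_iterate m loss \<alpha> w \<pi> j))"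

definition epoch_grad ::
  "nat \<Rightarrow> (nat \<Rightarrow> nat \<Rightarrow> 'a::real_inner \<Rightarrow> real) \<Rightarrow> real \<Rightarrow> 'a \<Rightarrow> (nat \<Rightarrow> nat list) \<Rightarrow> nat \<Rightarrow> nat \<Rightarrow> 'a" where
  "epoch_grad m loss \<alpha> w \<pi> i j = grad (loss i (\<pi> i ! j)) (inner_iterate m loss \<alpha> w \<pi> j)"

text \<open>
  The pair differences in the order in which they are fed: pairs in the outer loop, workers in the
  inner one.  The difference of pair \<open>k\<close> (positions \<open>2 * k\<close> and \<open>2 * k + 1\<close>) of worker \<open>i\<close> is at
  index \<open>k * m + i\<close>.
\<close>

definition pair_diffs ::
  "nat \<Rightarrow> nat \<Rightarrow> (nat \<Rightarrow> nat \<Rightarrow> 'a::real_inner \<Rightarrow> real) \<Rightarrow> real \<Rightarrow> 'a \<Rightarrow> (nat \<Rightarrow> nat list) \<Rightarrow> 'a list" where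
  "pair_diffs m n loss \<alpha> w \<pi> =
     [epoch_grad m loss \<alpha> w \<pi> i (2 * k) - epoch_grad m loss \<alpha> w \<pi> i (2 * k + 1).
        k \<leftarrow> [0..<n div 2], i \<leftarrow> [0..<m]]"

definition position_sign :: "nat \<Rightarrow> bool list \<Rightarrow> nat \<Rightarrow> nat \<Rightarrow> bool" where
  "position_sign m ss i j =
     (if even j then ss ! ((j div 2) * m + i) else \<not> ss ! ((j div 2) * m + i))"

definition reorder ::
  "nat \<Rightarrow> nat \<Rightarrow> bool list \<Rightarrow> (nat \<Rightarrow> nat list) \<Rightarrow> nat \<Rightarrow> nat list" where
  "reorder m n ss \<pi> i =
     [\<pi> i ! j. j \<leftarrow> [0..<n], position_sign m ss i j]
     @ rev [\<pi> i ! j. j \<leftarrow> [0..<n], \<not> position_sign m ss i j]"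

text \<open>
  Joint distribution of the weights and orders after \<open>t\<close> epochs, i.e. those with which epoch
  \<open>t + 1\<close> starts.
\<close>

primrec cdgrab ::
  "nat \<Rightarrow> nat \<Rightarrow> (nat \<Rightarrow> nat \<Rightarrow> 'a::real_inner \<Rightarrow> real) \<Rightarrow> ('a list \<Rightarrow> real) \<Rightarrow> real \<Rightarrow>
   'a \<Rightarrow> (nat \<Rightarrow> nat list) \<Rightarrow> nat \<Rightarrow> ('a \<times> (nat \<Rightarrow> nat list)) pmf" where
  "cdgrab m n loss thr \<alpha> w\<^sub>1 \<pi>\<^sub>1 0 = return_pmf (w\<^sub>1, \<pi>\<^sub>1)"
| "cdgrab m n loss thr \<alpha> w\<^sub>1 \<pi>\<^sub>1 (Suc t) =
     bind_pmf (cdgrab m n loss thr \<alpha> w\<^sub>1 \<pi>\<^sub>1 t)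
       (\<lambda>(w, \<pi>). map_pmf (\<lambda>ss. (inner_iterate m loss \<alpha> w \<pi> n, reorder m n ss \<pi>))
                    (balance_walk thr [] 0 (pair_diffs m n loss \<alpha> w \<pi>)))"

subsection \<open>Constants of the convergence bound\<close>

text \<open>Principal branch of the Lambert W function, for arguments at least \<open>- exp (- 1)\<close>.\<close>

definition Lambert_W0 :: "real \<Rightarrow> real" where
  "Lambert_W0 x = (THE w. w \<ge> - 1 \<and> w * exp w = x)"

text \<open>Below, \<open>F\<close> is the initial suboptimality, \<open>\<zeta>\<close> the heterogeneity bound and \<open>A\<close> the
  balancing constant.\<close>

definition C3_const ::
  "real \<Rightarrow> real \<Rightarrow> real \<Rightarrow> real \<Rightarrow> real \<Rightarrow> real \<Rightarrow> real" where
  "C3_const F \<sigma> \<zeta> L \<mu> A =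
     (F + \<sigma>\<^sup>2 / L) * \<mu>\<^sup>2 / (224 * L\<^sup>2 * (\<zeta> + \<sigma>)\<^sup>2 * A\<^sup>2)"

definition W_const ::
  "real \<Rightarrow> real \<Rightarrow> real \<Rightarrow> real \<Rightarrow> real \<Rightarrow> real \<Rightarrow> nat \<Rightarrow> nat \<Rightarrow> nat \<Rightarrow> real" where
  "W_const F \<sigma> \<zeta> L \<mu> A m n T =
     Lambert_W0 ((real m * real n * real T)\<^sup>2 * C3_const F \<sigma> \<zeta> L \<mu> A)"

definition cdgrab_bound ::
  "real \<Rightarrow> real \<Rightarrow> real \<Rightarrow> real \<Rightarrow> real \<Rightarrow> real \<Rightarrow> nat \<Rightarrow> nat \<Rightarrow> nat \<Rightarrow> real" where
  "cdgrab_bound F \<sigma> \<zeta> L \<mu> A m n T =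
     1 / (real m * real n * real T)\<^sup>2 *
       ((F + \<sigma>\<^sup>2 / L) * W_const F \<sigma> \<zeta> L \<mu> A m n T / C3_const F \<sigma> \<zeta> L \<mu> A
        + 112 * L\<^sup>2 * (\<zeta> + \<sigma>)\<^sup>2 * A\<^sup>2 * (W_const F \<sigma> \<zeta> L \<mu> A m n T)\<^sup>2 / \<mu> ^ 3)"

text \<open>
  Soft O: big O up to a power of the logarithmic factor \<open>l\<close>.  With a principal filter the implied
  constant is uniform over the underlying set.
\<close>

definition soft_bigo :: "'a filter \<Rightarrow> ('a \<Rightarrow> real) \<Rightarrow> ('a \<Rightarrow> real) \<Rightarrow> ('a \<Rightarrow> real) set" where
  "soft_bigo X l g = (\<Union>p::nat. O[X](\<lambda>x. l x ^ p * g x))"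

end

theory Submission
  imports Defs
begin

text \<open>Measure an order by the sup norm \<open>S\<close> of the prefix sums, over all workers, of the gradients at
  the epoch's starting point, centred at each worker's mean. If the signs of an epoch balance the pair
  differences, the next order satisfies \<open>S' \<le> S / 2 + A * \<sigma>\<close> up to a term controlled by the drift of
  the weights within the epoch; the drift is in turn controlled by \<open>S\<close> and the global gradient, and the
  gradient part is absorbed by the descent of the loss. Hence the gap plus a multiple of \<open>S\<^sup>2\<close>
  contracts by \<open>1 - \<alpha> * n * \<mu> / 2\<close> per epoch up to an additive error. Over \<open>T\<close> epochs the contraction
  factor is at most \<open>exp (- W)\<close>, and \<open>W * exp W = (m * n * T)\<^sup>2 * C\<^sub>3\<close> turns this into the stated rate.
  The contraction needs \<open>\<mu> \<le> L\<close>, which can only fail when the global loss is constant.\<close>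

section \<open>Gradients and the descent inequality\<close>

lemma GDERIV_unique:
  fixes D E :: "'a::real_inner"
  assumes "GDERIV f x :> D" and "GDERIV f x :> E"
  shows "D = E"
proof -
  have "(\<lambda>h. inner h D) = (\<lambda>h. inner h E)"
    using assms unfolding gderiv_def by (rule has_derivative_unique)
  then have "\<forall>h. inner h D = inner h E" by metis
  then show ?thesis by (simp add: vector_eq_ldot)
qed

lemma grad_eq: "GDERIV f x :> D \<Longrightarrow> grad f x = D"
  unfolding grad_def using GDERIV_unique by blast

lemma GDERIV_grad:
  fixes f :: "'a::euclidean_space \<Rightarrow> real"
  assumes "f differentiable (at x)"
  shows "GDERIV f x :> grad f x"
proof -
  obtain f' where f': "(f has_derivative f') (at x)"
    using assms unfolding differentiable_def by blast
  then have "linear f'" by (simp add: has_derivative_linear)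
  then have "f' = (\<lambda>h. inner h (adjoint f' 1))"
    using adjoint_works[of f' _ 1] by (auto simp: fun_eq_iff)
  then have "GDERIV f x :> adjoint f' 1"
    using f' unfolding gderiv_def by metis
  then show ?thesis using grad_eq by metis
qed

lemma GDERIV_sum:
  assumes "\<And>i. i \<in> I \<Longrightarrow> GDERIV (f i) x :> D i"
  shows "GDERIV (\<lambda>x. \<Sum>i\<in>I. f i x) x :> (\<Sum>i\<in>I. D i)"
  using assms unfolding gderiv_def
  by (auto simp: inner_sum_right intro: has_derivative_sum)

lemma GDERIV_divide:
  assumes "GDERIV f x :> D"
  shows "GDERIV (\<lambda>x. f x / c) x :> (1 / c) *\<^sub>R D"
proof -
  have "((\<lambda>x. (1 / c) * f x) has_derivative (\<lambda>h. (1 / c) * inner h D)) (at x)"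
    using assms unfolding gderiv_def by (rule has_derivative_mult_right)
  then show ?thesis unfolding gderiv_def by simp
qed

text \<open>Along the segment from \<open>x\<close> to \<open>y\<close>, the Lipschitz gradient
  makes \<open>f\<close> minus its quadratic upper model nonincreasing; comparing the two ends gives
  the bound.\<close>

lemma descent_lemma:
  fixes f :: "'a::real_inner \<Rightarrow> real"
  assumes deriv: "\<And>x. GDERIV f x :> g x"
    and lip: "\<And>x y. norm (g x - g y) \<le> L * norm (x - y)"
  shows "f y \<le> f x + inner (g x) (y - x) + L / 2 * (norm (y - x))\<^sup>2"
proof -
  define v where "v = y - x"
  define \<phi> where "\<phi> t = f (x + t *\<^sub>R v) - t * inner (g x) v - L / 2 * t\<^sup>2 * (norm v)\<^sup>2" for t
  have "\<phi> 1 \<le> \<phi> 0"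
  proof (rule DERIV_nonpos_imp_nonincreasing[of 0 1 \<phi>])
    fix t :: real
    assume t: "0 \<le> t" "t \<le> 1"
    have line: "((\<lambda>t. x + t *\<^sub>R v) has_derivative (\<lambda>h. h *\<^sub>R v)) (at t)"
      by (auto intro!: derivative_eq_intros)
    have "((\<lambda>t. f (x + t *\<^sub>R v)) has_derivative (\<lambda>h. inner (h *\<^sub>R v) (g (x + t *\<^sub>R v)))) (at t)"
      using has_derivative_compose[OF line deriv[unfolded gderiv_def]] .
    then have "((\<lambda>t. f (x + t *\<^sub>R v)) has_real_derivative inner (g (x + t *\<^sub>R v)) v) (at t)"
      unfolding has_field_derivative_def by (simp add: inner_commute mult.commute[of _ "inner _ _"])
    then have "(\<phi> has_real_derivative
        inner (g (x + t *\<^sub>R v)) v - inner (g x) v - L * t * (norm v)\<^sup>2) (at t)"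
      unfolding \<phi>_def by (auto intro!: derivative_eq_intros)
    moreover have "inner (g (x + t *\<^sub>R v)) v - inner (g x) v \<le> L * t * (norm v)\<^sup>2"
    proof -
      have "inner (g (x + t *\<^sub>R v) - g x) v \<le> norm (g (x + t *\<^sub>R v) - g x) * norm v"
        by (rule norm_cauchy_schwarz)
      also have "\<dots> \<le> L * norm (x + t *\<^sub>R v - x) * norm v"
        by (intro mult_right_mono lip) simp
      finally show ?thesis using t by (simp add: inner_diff_left power2_eq_square mult.assoc)
    qed
    ultimately show "\<exists>d. (\<phi> has_real_derivative d) (at t) \<and> d \<le> 0" by force
  qed simp
  then show ?thesis by (simp add: \<phi>_def v_def)
qed

section \<open>Norms of sums, list indexing and the reordered permutations\<close>

lemma infnorm_minus_le: "infnorm (x :: 'a::euclidean_space) \<le> infnorm y + infnorm (x - y)"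
  using infnorm_triangle[of y "x - y"] by simp

lemma norm_double_sum_le:
  fixes f :: "nat \<Rightarrow> nat \<Rightarrow> 'a::real_normed_vector"
  assumes "\<And>j i. j < k \<Longrightarrow> i < m \<Longrightarrow> norm (f j i) \<le> B"
  shows "norm (\<Sum>j<k. \<Sum>i<m. f j i) \<le> real k * real m * B"
proof -
  have "norm (\<Sum>i<m. f j i) \<le> real m * B" if "j < k" for j
    using sum_norm_le[of "{..<m}" "f j" "\<lambda>_. B"] assms[OF that] by simp
  then show ?thesis
    using sum_norm_le[of "{..<k}" "\<lambda>j. \<Sum>i<m. f j i" "\<lambda>_. real m * B"] by simp
qed

lemma sum_lessThan_double:
  fixes f :: "nat \<Rightarrow> 'a::comm_monoid_add"
  shows "(\<Sum>j<2 * k. f j) = (\<Sum>l<k. f (2 * l) + f (2 * l + 1))"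
  by (induction k) (simp_all add: add.assoc)

text \<open>Reads a pair difference off the feeding order: all blocks have the same length
  \<open>m\<close>, so the first \<open>h\<close> blocks fill exactly \<open>h * m\<close>
  places.\<close>

lemma nth_concat_map_upt:
  assumes "k < h" and "i < m"
  shows "concat (map (\<lambda>k. map (f k) [0..<m]) [0..<h]) ! (k * m + i) = f k i"
  using assms(1)
proof (induction h)
  case (Suc h)
  have len: "length (concat (map (\<lambda>k. map (f k) [0..<m]) [0..<h])) = h * m"
    by (simp add: length_concat comp_def sum_list_triv)
  show ?case
  proof (cases "k = h")
    case True
    then show ?thesis using len assms(2) by (simp add: nth_append)
  next
    case False
    then have "k < h" using Suc.prems by simp
    then have "Suc k * m \<le> h * m" by (intro mult_le_mono1 Suc_leI)
    then have "k * m + i < h * m" using assms(2) by simp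
    then show ?thesis using len Suc.IH[OF \<open>k < h\<close>] by (simp add: nth_append)
  qed
qed simp

text \<open>Exactly one member of each pair survives the filter, so the filtered list can be indexed
  by pairs.\<close>

lemma concat_map_if_pairs:
  assumes "\<And>l. l < h \<Longrightarrow> P (2 * l + 1) = (\<not> P (2 * l))"
  shows "concat (map (\<lambda>j. if P j then [f j] else []) [0..<2 * h]) =
         map (\<lambda>l. f (if P (2 * l) then 2 * l else 2 * l + 1)) [0..<h]"
  using assms by (induction h) auto

lemma concat_map_if: "concat (map (\<lambda>j. if P j then [f j] else []) xs) = map f (filter P xs)"
  by (induction xs) auto

text \<open>A filter and its complement split the multiset of positions, and reversal does not
  change a multiset.\<close>

lemma reorder_permutation:
  assumes "\<pi> i \<in> permutations_of_set {..<n}"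
  shows "reorder m n ss \<pi> i \<in> permutations_of_set {..<n}"
proof -
  have len: "length (\<pi> i) = n"
    using length_finite_permutations_of_set[OF assms] by simp
  have "mset (reorder m n ss \<pi> i) = image_mset (nth (\<pi> i)) (mset [0..<n])"
    unfolding reorder_def concat_map_if
    by (simp del: mset_upt flip: image_mset_union multiset_partition)
  also have "\<dots> = mset (map (nth (\<pi> i)) [0..<n])" by simp
  also have "map (nth (\<pi> i)) [0..<n] = \<pi> i"
    using len map_nth by metis
  finally have "mset (reorder m n ss \<pi> i) = mset (\<pi> i)" .
  then show ?thesis
    using assms unfolding permutations_of_set_def
    by (auto dest: mset_eq_setD mset_eq_imp_distinct_iff)
qed

text \<open>Each pair has one positive and one negative position, so both halves have length
  \<open>h\<close> and the \<open>l\<close>-th entry from either end belongs to pair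
  \<open>l\<close>. Comparing with \<open>True\<close> and \<open>False\<close> gives both halves
  the same shape, so that one argument with a Boolean parameter can treat them together.\<close>

lemma
  assumes "n = 2 * h" and "l < h"
  shows nth_reorder_front:
      "reorder m n ss \<pi> i ! l = \<pi> i ! (if ss ! (l * m + i) = True then 2 * l else 2 * l + 1)"
    and nth_reorder_back:
      "reorder m n ss \<pi> i ! (n - 1 - l) = \<pi> i ! (if ss ! (l * m + i) = False then 2 * l else 2 * l + 1)"
proof -
  have "reorder m n ss \<pi> i =
      map (\<lambda>l. \<pi> i ! (if position_sign m ss i (2 * l) then 2 * l else 2 * l + 1)) [0..<h] @
      rev (map (\<lambda>l. \<pi> i ! (if \<not> position_sign m ss i (2 * l) then 2 * l else 2 * l + 1)) [0..<h])"
    unfolding reorder_def assms(1)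
    by (subst (1 2) concat_map_if_pairs) (auto simp: position_sign_def)
  then have *: "reorder m n ss \<pi> i =
      map (\<lambda>l. \<pi> i ! (if ss ! (l * m + i) = True then 2 * l else 2 * l + 1)) [0..<h] @
      rev (map (\<lambda>l. \<pi> i ! (if ss ! (l * m + i) = False then 2 * l else 2 * l + 1)) [0..<h])"
    by (simp add: position_sign_def)
  show "reorder m n ss \<pi> i ! l = \<pi> i ! (if ss ! (l * m + i) = True then 2 * l else 2 * l + 1)"
    unfolding * using assms(2) by (simp add: nth_append)
  have rear: "(xs @ rev (map f [0..<h])) ! (n - 1 - l) = f l" if "length xs = h" for xs f
  proof -
    have "n - 1 - l = length xs + (h - 1 - l)" using assms that by simp
    then have "(xs @ rev (map f [0..<h])) ! (n - 1 - l) = rev (map f [0..<h]) ! (h - 1 - l)"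
      by (simp only: nth_append_length_plus)
    also have "\<dots> = f l" using assms(2) by (simp add: rev_nth)
    finally show ?thesis .
  qed
  show "reorder m n ss \<pi> i ! (n - 1 - l) =
      \<pi> i ! (if ss ! (l * m + i) = False then 2 * l else 2 * l + 1)"
    unfolding * by (rule rear) simp
qed

lemma inner_iterate_diff:
  "inner_iterate m loss \<alpha> w \<pi> k - w =
     - ((\<alpha> / m) *\<^sub>R (\<Sum>j<k. \<Sum>i<m. grad (loss i (\<pi> i ! j)) (inner_iterate m loss \<alpha> w \<pi> j)))"
  by (induction k) (simp_all add: scaleR_add_right)

lemma sum_nth_permutation:
  assumes "xs \<in> permutations_of_set {..<n}"
  shows "(\<Sum>j<n. f (xs ! j)) = (\<Sum>e<n. f e)"
proof -
  have "length xs = n" "distinct xs" "set xs = {..<n}"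
    using assms length_finite_permutations_of_set[OF assms] by (auto simp: permutations_of_set_def)
  then have "bij_betw (nth xs) {..<n} {..<n}" by (metis bij_betw_nth)
  then show ?thesis by (rule sum.reindex_bij_betw)
qed

lemma nth_permutation_less:
  assumes "xs \<in> permutations_of_set {..<n}" and "j < n"
  shows "xs ! j < n"
  using assms length_finite_permutations_of_set[OF assms(1)] nth_mem[of j xs]
  by (auto simp: permutations_of_set_def)

section \<open>Probability over the epochs\<close>

lemma prob_bind_pmf_ge:
  fixes q :: real
  assumes "\<And>x. x \<in> S \<Longrightarrow> q \<le> measure_pmf.prob (f x) S'" and "0 \<le> q"
  shows "q * measure_pmf.prob M S \<le> measure_pmf.prob (bind_pmf M f) S'"
proof -
  have "q * measure_pmf.prob M S = (\<integral>x. q * indicator S x \<partial>measure_pmf M)" by simp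
  also have "\<dots> \<le> (\<integral>x. measure_pmf.prob (f x) S' \<partial>measure_pmf M)"
    by (intro integral_mono measure_pmf.integrable_const_bound[where B = 1]
          measure_pmf.integrable_const_bound[where B = q])
      (use assms in \<open>auto split: split_indicator\<close>)
  also have "\<dots> = measure_pmf.prob (bind_pmf M f) S'"
    unfolding measure_pmf_bind
    by (subst measure_pmf.measure_bind[where N = "count_space UNIV"])
      (auto simp: space_subprob_algebra intro!: measurable_pmf_measure1 subprob_space_measure_pmf)
  finally show ?thesis .
qed

text \<open>Given the state at the start of an epoch, the vectors fed to the balancing are fixed, so
  a guarantee stated per state applies to the fresh signs. The failure probabilities then add up
  along an invariant that may change with \<open>t\<close>.\<close>

lemma prob_cdgrab_ge:
  assumes init: "(w\<^sub>1, \<pi>\<^sub>1) \<in> I 0"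
    and step: "\<And>t w \<pi>. (w, \<pi>) \<in> I t \<Longrightarrow>
      1 - \<delta> \<le> measure_pmf.prob (balance_walk thr [] 0 (pair_diffs m n loss \<alpha> w \<pi>))
                {ss. (inner_iterate m loss \<alpha> w \<pi> n, reorder m n ss \<pi>) \<in> I (Suc t)}"
    and \<delta>: "0 \<le> \<delta>" "\<delta> \<le> 1"
  shows "1 - real t * \<delta> \<le> measure_pmf.prob (cdgrab m n loss thr \<alpha> w\<^sub>1 \<pi>\<^sub>1 t) (I t)"
proof (induction t)
  case 0
  then show ?case using init by simp
next
  case (Suc t)
  \<comment> \<open>The right side exceeds the left by
    \<open>real t * \<delta>\<^sup>2\<close>.\<close>
  have "1 - real (Suc t) * \<delta> \<le> (1 - \<delta>) * (1 - real t * \<delta>)"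
    using \<delta> by (simp add: algebra_simps)
  also have "\<dots> \<le> (1 - \<delta>) * measure_pmf.prob (cdgrab m n loss thr \<alpha> w\<^sub>1 \<pi>\<^sub>1 t) (I t)"
    using Suc \<delta> by (intro mult_left_mono) auto
  also have "\<dots> \<le> measure_pmf.prob (cdgrab m n loss thr \<alpha> w\<^sub>1 \<pi>\<^sub>1 (Suc t)) (I (Suc t))"
    unfolding cdgrab.simps
    by (rule prob_bind_pmf_ge) (use step \<delta> in \<open>auto simp: vimage_def\<close>)
  finally show ?case .
qed

section \<open>The Lambert W function at positive arguments\<close>

lemma Lambert_W0:
  assumes "x > 0"
  shows "Lambert_W0 x > 0" and "Lambert_W0 x * exp (Lambert_W0 x) = x"
proof -
  have "\<exists>w\<ge>0. w \<le> x \<and> w * exp w = x"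
    using assms by (intro IVT) (auto intro!: continuous_intros)
  then obtain w where w: "w \<ge> 0" "w * exp w = x" by blast
  \<comment> \<open>A positive value forces a positive argument, so uniqueness needs the
    monotonicity of \<open>v * exp v\<close> only on the positive half-line.\<close>
  have pos: "v > 0" if "v * exp v = x" for v
    using that assms by (metis exp_gt_zero zero_less_mult_pos2)
  have less: "u * exp u < v * exp v" if "0 < u" "u < v" for u v :: real
    using that by (intro mult_strict_mono) auto
  have "Lambert_W0 x = w"
    unfolding Lambert_W0_def
  proof (rule the_equality)
    fix v assume "v \<ge> - 1 \<and> v * exp v = x"
    then show "v = w" using w pos[of v] pos[of w] less[of v w] less[of w v] by force
  qed (use w in auto)
  then show "Lambert_W0 x > 0" "Lambert_W0 x * exp (Lambert_W0 x) = x"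
    using w pos by auto
qed


section \<open>Arithmetic of the contraction in one epoch\<close>

lemma square_add_le: "(x + y)\<^sup>2 \<le> 2 * x\<^sup>2 + 2 * (y :: real)\<^sup>2"
  using sum_squares_bound[of x y] by (simp add: power2_sum)

text \<open>The potential is the gap plus \<open>7/2 * \<gamma> * L\<^sup>2\<close> times the square of the scaled prefix bound. Only
  \<open>14 = 4 * 7/2\<close> is forced by the target bound; the other numbers are rounded.\<close>

lemma lyapunov_arith:
  fixes \<gamma> :: real
  assumes pos: "\<gamma> > 0" "L > 0" "0 \<le> a" "0 \<le> s" "0 \<le> G" "0 \<le> s'"
    and small: "2 * (\<gamma> * L) + a \<le> 1 / 16"
    and "\<mu> \<le> L" and PL: "G\<^sup>2 \<ge> 2 * (\<mu> * F)"
    and D: "D = (s + \<gamma> * G) / (1 - \<gamma> * L)"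
    and F': "F' \<le> F - \<gamma> / 2 * G\<^sup>2 + \<gamma> / 2 * (L\<^sup>2 * D\<^sup>2)"
    and s': "s' = s / 2 + B + (a + 3 / 2 * (\<gamma> * L)) * D"
  shows "F' + 7 / 2 * \<gamma> * L\<^sup>2 * s'\<^sup>2
      \<le> (1 - \<gamma> * \<mu> / 2) * (F + 7 / 2 * \<gamma> * L\<^sup>2 * s\<^sup>2) + 14 * \<gamma> * L\<^sup>2 * B\<^sup>2"
proof -
  \<comment> \<open>Intended values: \<open>\<gamma>\<close> is the epoch step
    \<open>\<alpha> * n\<close>, \<open>s\<close> and \<open>s'\<close> are the prefix bounds scaled
    by \<open>\<alpha> / m\<close>, \<open>a\<close> is \<open>\<alpha> * A * L / m\<close>,
    \<open>B\<close> is \<open>\<alpha> * A * \<sigma> / m\<close>, \<open>G\<close> is the norm of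
    the global gradient, and \<open>D\<close> bounds the drift.\<close>
  have \<gamma>L: "0 \<le> \<gamma> * L" "\<gamma> * L \<le> 1 / 32" using pos small by simp_all
  have num: "0 \<le> s + \<gamma> * G" using pos by simp
  have D0: "0 \<le> D" unfolding D using num \<gamma>L by simp
  have "D \<le> (s + \<gamma> * G) / (31 / 32)"
    unfolding D using num \<gamma>L by (intro divide_left_mono) auto
  then have D1: "D \<le> 32 / 31 * (s + \<gamma> * G)" by simp
  have "D\<^sup>2 \<le> (32 / 31 * (s + \<gamma> * G))\<^sup>2" using D0 D1 by (intro power_mono)
  also have "\<dots> \<le> (32 / 31)\<^sup>2 * (2 * s\<^sup>2 + 2 * (\<gamma> * G)\<^sup>2)"
    unfolding power_mult_distrib[of "32 / 31"] by (intro mult_left_mono square_add_le) simp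
  finally have D2: "D\<^sup>2 \<le> (32 / 31)\<^sup>2 * (2 * s\<^sup>2 + 2 * (\<gamma> * G)\<^sup>2)" .
  have "a + 3 / 2 * (\<gamma> * L) \<le> 1 / 16" using small \<gamma>L by linarith
  then have "(a + 3 / 2 * (\<gamma> * L)) * D \<le> 1 / 16 * D" using D0 by (rule mult_right_mono)
  \<comment> \<open>Here 35/62 = 1/2 + 1/16 * 32/31: the halving of \<open>s\<close> is only
    slightly spoiled by the feedback through the drift.\<close>
  then have "s' \<le> 35 / 62 * s + (B + 2 / 31 * (\<gamma> * G))" unfolding s' using D1 by simp
  then have "s'\<^sup>2 \<le> (35 / 62 * s + (B + 2 / 31 * (\<gamma> * G)))\<^sup>2" using pos by (intro power_mono)
  also have "\<dots> \<le> 2 * (35 / 62 * s)\<^sup>2 + 2 * (B + 2 / 31 * (\<gamma> * G))\<^sup>2" by (rule square_add_le)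
  also have "\<dots> \<le> 2 * (35 / 62 * s)\<^sup>2 + 2 * (2 * B\<^sup>2 + 2 * (2 / 31 * (\<gamma> * G))\<^sup>2)"
    by (intro add_left_mono mult_left_mono square_add_le) simp
  finally have s2: "s'\<^sup>2 \<le> 2 * (35 / 62)\<^sup>2 * s\<^sup>2 + 4 * B\<^sup>2 + 4 * (2 / 31)\<^sup>2 * (\<gamma> * G)\<^sup>2"
    by (simp add: power_mult_distrib power_divide)
  \<comment> \<open>In these three quantities (prefix bound, gradient, balancing error) the
    remaining comparison is linear.\<close>
  define X Y Z where "X = \<gamma> * (L\<^sup>2 * s\<^sup>2)" and "Y = \<gamma> * G\<^sup>2" and "Z = \<gamma> * (L\<^sup>2 * B\<^sup>2)"
  have XY: "0 \<le> X" "0 \<le> Y" using pos by (simp_all add: X_def Y_def)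
  have "(\<gamma> * L)\<^sup>2 * G\<^sup>2 \<le> (1 / 32)\<^sup>2 * G\<^sup>2"
    using \<gamma>L by (intro mult_right_mono power_mono) auto
  then have "\<gamma> * ((\<gamma> * L)\<^sup>2 * G\<^sup>2) \<le> \<gamma> * ((1 / 32)\<^sup>2 * G\<^sup>2)"
    using pos by (intro mult_left_mono) auto
  then have GY: "\<gamma> * (L\<^sup>2 * (\<gamma> * G)\<^sup>2) \<le> Y / 1024"
    by (simp add: Y_def power_mult_distrib mult_ac power_divide)
  have "\<gamma> * (L\<^sup>2 * D\<^sup>2) \<le> \<gamma> * (L\<^sup>2 * ((32 / 31)\<^sup>2 * (2 * s\<^sup>2 + 2 * (\<gamma> * G)\<^sup>2)))"
    using pos D2 by (intro mult_left_mono) auto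
  also have "\<dots> = 2048 / 961 * X + 2048 / 961 * (\<gamma> * (L\<^sup>2 * (\<gamma> * G)\<^sup>2))"
    by (simp add: X_def algebra_simps power_divide)
  finally have DX: "\<gamma> * (L\<^sup>2 * D\<^sup>2) \<le> 2048 / 961 * X + 2048 / 961 * (Y / 1024)" using GY by linarith
  have "\<gamma> * (L\<^sup>2 * s'\<^sup>2) \<le> \<gamma> * (L\<^sup>2 * (2 * (35 / 62)\<^sup>2 * s\<^sup>2 + 4 * B\<^sup>2 + 4 * (2 / 31)\<^sup>2 * (\<gamma> * G)\<^sup>2))"
    using pos s2 by (intro mult_left_mono) auto
  also have "\<dots> = 1225 / 1922 * X + 4 * Z + 16 / 961 * (\<gamma> * (L\<^sup>2 * (\<gamma> * G)\<^sup>2))"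
    by (simp add: X_def Z_def algebra_simps power_divide)
  finally have sX: "\<gamma> * (L\<^sup>2 * s'\<^sup>2) \<le> 1225 / 1922 * X + 4 * Z + 16 / 961 * (Y / 1024)" using GY by linarith
  \<comment> \<open>By the P.L. condition half of the decrease \<open>Y / 2\<close> pays for the
    contraction of the gap; the other half absorbs the gradient part of the drift.\<close>
  have "\<gamma> * (2 * (\<mu> * F)) \<le> Y" unfolding Y_def using pos PL by (intro mult_left_mono) auto
  then have gap: "\<gamma> * \<mu> / 2 * F \<le> Y / 4" by (simp add: mult_ac)
  have "\<gamma> * \<mu> \<le> \<gamma> * L" using pos \<open>\<mu> \<le> L\<close> by simp
  then have potential: "\<gamma> * \<mu> / 2 * (7 / 2 * X) \<le> 1 / 64 * (7 / 2 * X)"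
    using \<gamma>L XY by (intro mult_right_mono) auto
  define U V where "U = \<gamma> * \<mu> / 2 * F" and "V = \<gamma> * \<mu> / 2 * (7 / 2 * X)"
  have UV: "U \<le> Y / 4" "V \<le> 1 / 64 * (7 / 2 * X)"
    unfolding U_def V_def by (rule gap, rule potential)
  have "F' \<le> F - Y / 2 + (\<gamma> * (L\<^sup>2 * D\<^sup>2)) / 2" using F' by (simp add: Y_def)
  \<comment> \<open>The coefficients of \<open>X\<close> are 1024/961 from the drift, 7/2 *
    1225/1922 from the new prefix bound and 7/128 from the contraction; their sum is below
    7/2.\<close>
  then have "F' + 7 / 2 * (\<gamma> * (L\<^sup>2 * s'\<^sup>2)) \<le> F + 7 / 2 * X - U - V + 14 * Z"
    using UV DX sX XY by linarith
  then show ?thesis by (simp add: U_def V_def X_def Z_def algebra_simps diff_divide_distrib)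
qed

section \<open>Size of the bound up to logarithms\<close>

lemma Lambert_W0_zero: "Lambert_W0 0 = 0"
  unfolding Lambert_W0_def by (rule the_equality) auto

text \<open>From \<open>1 - w \<le> exp (- w)\<close> follows
  \<open>exp w \<le> 1 + w * exp w\<close>, and the right side is \<open>1 + x\<close> at the
  Lambert value.\<close>

lemma Lambert_W0_le_ln:
  assumes "x > 0"
  shows "Lambert_W0 x \<le> ln (1 + x)"
proof -
  let ?w = "Lambert_W0 x"
  have "1 - ?w \<le> exp (- ?w)" using exp_ge_add_one_self[of "- ?w"] by simp
  then have "(1 - ?w) * exp ?w \<le> exp (- ?w) * exp ?w" by (rule mult_right_mono) simp
  then have "exp ?w \<le> 1 + ?w * exp ?w" by (simp add: algebra_simps flip: exp_add)
  then have "exp ?w \<le> 1 + x" using Lambert_W0(2)[OF assms] by simp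
  then show ?thesis using assms by (subst ln_ge_iff) auto
qed

text \<open>Both logarithms are at least 1 because 4 exceeds e, so the radicand is nonnegative and
  even at least 1.\<close>

lemma balance_const_square:
  assumes "d > 0" and "N > 0" and "0 < \<delta>" and "\<delta> < 1"
  shows "(balance_const d N \<delta>)\<^sup>2 = 2 * ln (4 * real d / \<delta>) * ln (4 * real N / \<delta>)"
    and "balance_const d N \<delta> \<ge> 1"
proof -
  have ln_ge: "1 \<le> ln (4 * real k / \<delta>)" if "k > 0" for k
  proof -
    have "exp 1 \<le> (4::real)" using exp_le by linarith
    also have "\<dots> \<le> 4 * real k / \<delta>"
      using that assms by (simp add: field_simps)
    finally show ?thesis using that assms by (subst ln_ge_iff) auto
  qed
  have "1 * 1 \<le> ln (4 * real d / \<delta>) * ln (4 * real N / \<delta>)"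
    using ln_ge assms by (intro mult_mono) (auto intro: order.trans[of 0 1])
  then have *: "1 \<le> 2 * ln (4 * real d / \<delta>) * ln (4 * real N / \<delta>)" by simp
  then show "(balance_const d N \<delta>)\<^sup>2 = 2 * ln (4 * real d / \<delta>) * ln (4 * real N / \<delta>)"
    "balance_const d N \<delta> \<ge> 1"
    unfolding balance_const_def using order.trans[OF zero_le_one *]
    by (simp_all only: real_sqrt_pow2 real_sqrt_ge_1_iff)
qed

text \<open>With \<open>l\<close> the logarithmic factor, \<open>A\<^sup>2\<close> is at most
  \<open>2 * l\<^sup>2\<close> and \<open>W\<close> at most a constant times \<open>l\<close>. Hence
  both summands of the bound carry at most the fourth power of \<open>l\<close>, with a constant
  depending only on the fixed parameters.\<close>

lemma cdgrab_bound_soft_bigo: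
  fixes F \<sigma> \<zeta> L \<mu> :: real
  assumes pos: "F \<ge> 0" "\<sigma> > 0" "\<zeta> > 0" "L > 0" "\<mu> > 0"
  shows "(\<lambda>(m, n, T, d, \<delta>). cdgrab_bound F \<sigma> \<zeta> L \<mu> (balance_const d (m * n) \<delta>) m n T)
    \<in> soft_bigo (principal {(m, n, T, d, \<delta>). m > 0 \<and> n > 0 \<and> T > 0 \<and> d > 0 \<and> 0 < \<delta> \<and> \<delta> < 1})
        (\<lambda>(m, n, T, d, \<delta>). ln (4 * real m * real n * real T * real d / \<delta>))
        (\<lambda>(m, n, T, d, \<delta>). 1 / (real m * real n * real T)\<^sup>2)"
proof -
  define Q where "Q = F + \<sigma>\<^sup>2 / L"
  define c where "c = 224 * L\<^sup>2 * (\<zeta> + \<sigma>)\<^sup>2"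
  define \<kappa> where "\<kappa> = Q * \<mu>\<^sup>2 / c"
  \<comment> \<open>The constant in \<open>W \<le> k * l\<close>; the summand 2 comes from
    \<open>P\<^sup>2\<close> inside the logarithm.\<close>
  define k where "k = ln (1 + \<kappa>) + 2"
  define K where "K = 2 * k * c / \<mu>\<^sup>2 + c * k\<^sup>2 / \<mu> ^ 3"
  have "Q > 0" unfolding Q_def using pos by (intro add_nonneg_pos) auto
  have "c > 0" unfolding c_def using pos by simp
  have "\<kappa> > 0" unfolding \<kappa>_def using \<open>Q > 0\<close> \<open>c > 0\<close> pos by simp
  then have k: "k \<ge> 2" by (simp add: k_def)
  have bound: "\<bar>cdgrab_bound F \<sigma> \<zeta> L \<mu> (balance_const d (m * n) \<delta>) m n T\<bar>
      \<le> K * \<bar>ln (4 * real m * real n * real T * real d / \<delta>) ^ 4 * (1 / (real m * real n * real T)\<^sup>2)\<bar>"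
    if "m > 0" "n > 0" "T > 0" "d > 0" and \<delta>: "0 < \<delta>" "\<delta> < 1" for m n T d :: nat and \<delta> :: real
  proof -
    define A where "A = balance_const d (m * n) \<delta>"
    define P where "P = real m * real n * real T"
    define l where "l = ln (4 * real m * real n * real T * real d / \<delta>)"
    define W where "W = W_const F \<sigma> \<zeta> L \<mu> A m n T"
    have ge1: "real m \<ge> 1" "real n \<ge> 1" "real T \<ge> 1" "real d \<ge> 1" using that by simp_all
    have prod_ge: "1 \<le> x * y" if "1 \<le> x" "1 \<le> y" for x y :: real
      using mult_mono[of 1 x 1 y] that by simp
    have P: "P \<ge> 1" unfolding P_def by (intro prod_ge ge1)
    have ln_le: "ln (4 * x / \<delta>) \<le> l" if "0 < x" "x \<le> real m * real n * real T * real d" for x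
      unfolding l_def using that \<delta> ge1 by (subst ln_le_cancel_iff) (auto intro!: divide_right_mono mult_pos_pos)
    have le1: "real d \<le> real m * real n * real T * real d"
      using mult_right_mono[of 1 "real m * real n * real T" "real d"] P by (simp add: P_def)
    have le2: "real (m * n) \<le> real m * real n * real T * real d"
      using mult_left_mono[of 1 "real T * real d" "real m * real n"] prod_ge[of "real T" "real d"] ge1
      by (simp add: mult.assoc)
    have A: "A\<^sup>2 = 2 * ln (4 * real d / \<delta>) * ln (4 * real (m * n) / \<delta>)" "A \<ge> 1"
      unfolding A_def using balance_const_square[of d "m * n" \<delta>] that by simp_all
    have ln_pos: "0 \<le> ln (4 * x / \<delta>)" if "1 \<le> x" for x
    proof (rule ln_ge_zero)
      show "1 \<le> 4 * x / \<delta>" using that \<delta> by (simp add: field_simps)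
    qed
    have "ln (4 * real d / \<delta>) * ln (4 * real (m * n) / \<delta>) \<le> l * l"
      using that ge1 le1 le2 prod_ge[of "real m" "real n"]
      by (intro mult_mono ln_le order.trans[OF ln_pos ln_le[of "real d"]] ln_pos) auto
    then have Al: "A\<^sup>2 \<le> 2 * l\<^sup>2" unfolding A(1) by (simp add: power2_eq_square)
    have "1 \<le> A\<^sup>2" using A(2) by (simp add: one_le_power)
    have "P \<le> 4 * real m * real n * real T * real d / \<delta>" "exp 1 \<le> 4 * real m * real n * real T * real d / \<delta>"
    proof -
      have "1 \<le> real d / \<delta>" using ge1 \<delta> by simp
      then have "P * 1 \<le> P * (real d / \<delta>)" using P by (intro mult_left_mono) auto
      then have *: "4 * P \<le> 4 * real m * real n * real T * real d / \<delta>" by (simp add: P_def)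
      then show "P \<le> 4 * real m * real n * real T * real d / \<delta>" using P by linarith
      show "exp 1 \<le> 4 * real m * real n * real T * real d / \<delta>" using * P exp_le by linarith
    qed
    then have lP: "ln P \<le> l" and l1: "1 \<le> l"
      unfolding l_def using P exp_gt_zero[of "1::real"]
      by (auto simp: ln_ge_iff[OF less_le_trans[OF exp_gt_zero]] intro!: ln_mono)
    have C3: "C3_const F \<sigma> \<zeta> L \<mu> A = \<kappa> / A\<^sup>2"
      by (simp add: C3_const_def \<kappa>_def c_def Q_def)
    have "\<kappa> / A\<^sup>2 > 0" using \<open>\<kappa> > 0\<close> A(2) by simp
    define x where "x = P\<^sup>2 * (\<kappa> / A\<^sup>2)"
    have x: "x > 0" "W = Lambert_W0 x"
      using \<open>\<kappa> / A\<^sup>2 > 0\<close> P by (auto simp: x_def W_def W_const_def C3 simp flip: P_def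
          intro!: mult_pos_pos simp del: times_divide_eq_right)
    \<comment> \<open>Since \<open>A \<ge> 1\<close>, dropping \<open>A\<close> only enlarges the
      argument of the Lambert function.\<close>
    have "\<kappa> / A\<^sup>2 \<le> \<kappa>" using \<open>1 \<le> A\<^sup>2\<close> \<open>\<kappa> > 0\<close> by (simp add: divide_le_eq)
    then have "x \<le> P\<^sup>2 * \<kappa>" unfolding x_def by (intro mult_left_mono) auto
    then have "1 + x \<le> P\<^sup>2 * (1 + \<kappa>)"
      using one_le_power[OF P, of 2] unfolding distrib_left by linarith
    then have "ln (1 + x) \<le> ln (P\<^sup>2 * (1 + \<kappa>))" using x by (intro ln_mono) auto
    also have "\<dots> = 2 * ln P + ln (1 + \<kappa>)"
      using P \<open>\<kappa> > 0\<close> by (simp add: ln_mult ln_realpow)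
    also have "\<dots> \<le> 2 * l + ln (1 + \<kappa>) * l"
      using lP l1 \<open>\<kappa> > 0\<close> by (intro add_mono) (auto simp: mult_le_cancel_left1)
    finally have W: "W \<le> k * l" "0 \<le> W"
      using Lambert_W0_le_ln[OF x(1)] Lambert_W0(1)[OF x(1)] x(2) by (simp_all add: k_def algebra_simps)
    have "W * A\<^sup>2 \<le> (k * l) * (2 * l\<^sup>2)" using W Al k l1 by (intro mult_mono) auto
    also have "\<dots> = 2 * k * l ^ 3" by (simp add: power2_eq_square power3_eq_cube)
    \<comment> \<open>The third power suffices here; it is raised to match the second summand, using
      \<open>l \<ge> 1\<close>.\<close>
    also have "\<dots> \<le> 2 * k * l ^ 4" using k l1 by (intro mult_left_mono power_increasing) auto
    finally have t1: "W * A\<^sup>2 \<le> 2 * k * l ^ 4" .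
    have "A\<^sup>2 * W\<^sup>2 \<le> (2 * l\<^sup>2) * (k * l)\<^sup>2" using W Al by (intro mult_mono power_mono) auto
    also have "\<dots> = 2 * k\<^sup>2 * l ^ 4" by (simp add: power_mult_distrib power2_eq_square power4_eq_xxxx)
    finally have t2: "A\<^sup>2 * W\<^sup>2 \<le> 2 * k\<^sup>2 * l ^ 4" .
    have "Q * W / (\<kappa> / A\<^sup>2) = c / \<mu>\<^sup>2 * (W * A\<^sup>2)"
      using \<open>Q > 0\<close> \<open>c > 0\<close> pos by (simp add: \<kappa>_def field_simps)
    also have "\<dots> \<le> c / \<mu>\<^sup>2 * (2 * k * l ^ 4)" using t1 \<open>c > 0\<close> by (intro mult_left_mono) auto
    finally have b1: "Q * W / (\<kappa> / A\<^sup>2) \<le> 2 * k * c / \<mu>\<^sup>2 * l ^ 4" by (simp add: field_simps)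
    have "112 * L\<^sup>2 * (\<zeta> + \<sigma>)\<^sup>2 * A\<^sup>2 * W\<^sup>2 / \<mu> ^ 3 = c / (2 * \<mu> ^ 3) * (A\<^sup>2 * W\<^sup>2)" by (simp add: c_def)
    also have "\<dots> \<le> c / (2 * \<mu> ^ 3) * (2 * k\<^sup>2 * l ^ 4)" using t2 \<open>c > 0\<close> pos by (intro mult_left_mono) auto
    finally have b2: "112 * L\<^sup>2 * (\<zeta> + \<sigma>)\<^sup>2 * A\<^sup>2 * W\<^sup>2 / \<mu> ^ 3 \<le> c * k\<^sup>2 / \<mu> ^ 3 * l ^ 4" by simp
    have eq: "cdgrab_bound F \<sigma> \<zeta> L \<mu> A m n T =
        1 / P\<^sup>2 * (Q * W / (\<kappa> / A\<^sup>2) + 112 * L\<^sup>2 * (\<zeta> + \<sigma>)\<^sup>2 * A\<^sup>2 * W\<^sup>2 / \<mu> ^ 3)"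
      by (simp add: cdgrab_bound_def C3 P_def Q_def flip: W_def)
    have "0 \<le> Q * W / (\<kappa> / A\<^sup>2) + 112 * L\<^sup>2 * (\<zeta> + \<sigma>)\<^sup>2 * A\<^sup>2 * W\<^sup>2 / \<mu> ^ 3"
      using \<open>Q > 0\<close> W \<open>\<kappa> / A\<^sup>2 > 0\<close> pos by (intro add_nonneg_nonneg divide_nonneg_pos mult_nonneg_nonneg) auto
    then have "\<bar>cdgrab_bound F \<sigma> \<zeta> L \<mu> A m n T\<bar> = cdgrab_bound F \<sigma> \<zeta> L \<mu> A m n T"
      unfolding eq by simp
    also have "\<dots> \<le> 1 / P\<^sup>2 * (K * l ^ 4)"
      unfolding eq K_def distrib_right using b1 b2 by (intro mult_left_mono add_mono) auto
    also have "\<dots> = K * \<bar>l ^ 4 * (1 / P\<^sup>2)\<bar>" using l1 by (simp add: abs_mult)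
    finally show ?thesis by (simp add: A_def P_def l_def)
  qed
  show ?thesis
    unfolding soft_bigo_def UN_iff
    by (rule bexI[of _ 4], rule bigoI[of _ K])
      (use bound in \<open>auto simp: eventually_principal split: prod.splits\<close>)
qed

section \<open>Smoothness of the local and global losses\<close>

locale cdgrab_losses =
  fixes m n :: nat and loss :: "nat \<Rightarrow> nat \<Rightarrow> 'a::euclidean_space \<Rightarrow> real" and L \<sigma> :: real
  assumes m_pos: "m > 0" and n_pos: "n > 0" and even_n: "even n"
    and L_pos: "L > 0" and \<sigma>_pos: "\<sigma> > 0"
    and differentiable: "\<And>i j w. i < m \<Longrightarrow> j < n \<Longrightarrow> loss i j differentiable (at w)"
    and variance: "\<And>i j w. i < m \<Longrightarrow> j < n \<Longrightarrow>
           (norm (grad (loss i j) w - grad (local_loss n loss i) w))\<^sup>2 \<le> \<sigma>\<^sup>2"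
    and smooth: "\<And>i j w v. i < m \<Longrightarrow> j < n \<Longrightarrow>
           norm (grad (loss i j) w - grad (loss i j) v) \<le> L * infnorm (w - v)"
begin

lemma GDERIV_local:
  assumes "i < m"
  shows "GDERIV (local_loss n loss i) w :> (1 / real n) *\<^sub>R (\<Sum>j<n. grad (loss i j) w)"
  unfolding local_loss_def[abs_def]
  by (intro GDERIV_divide GDERIV_sum GDERIV_grad differentiable assms) simp

lemma grad_local: "i < m \<Longrightarrow> grad (local_loss n loss i) w = (1 / real n) *\<^sub>R (\<Sum>j<n. grad (loss i j) w)"
  by (rule grad_eq) (rule GDERIV_local)

lemma GDERIV_global:
  "GDERIV (global_loss m n loss) w :> (1 / real m) *\<^sub>R (\<Sum>i<m. grad (local_loss n loss i) w)"
  unfolding global_loss_def[abs_def]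
proof (intro GDERIV_divide GDERIV_sum)
  show "GDERIV (local_loss n loss i) w :> grad (local_loss n loss i) w" if "i \<in> {..<m}" for i
    using GDERIV_local[of i w] grad_local[of i w] that by simp
qed

lemma grad_global: "grad (global_loss m n loss) w = (1 / real m) *\<^sub>R (\<Sum>i<m. grad (local_loss n loss i) w)"
  by (rule grad_eq) (rule GDERIV_global)

lemma local_smooth:
  assumes "i < m"
  shows "norm (grad (local_loss n loss i) w - grad (local_loss n loss i) v) \<le> L * infnorm (w - v)"
proof -
  have "norm (\<Sum>j<n. grad (loss i j) w - grad (loss i j) v) \<le> (\<Sum>j<n. L * infnorm (w - v))"
    by (rule sum_norm_le) (use smooth assms in auto)
  then have "norm (\<Sum>j<n. grad (loss i j) w - grad (loss i j) v) / n \<le> L * infnorm (w - v)"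
    using n_pos by (simp add: field_simps)
  then show ?thesis
    by (simp add: grad_local[OF assms] flip: scaleR_diff_right sum_subtractf)
qed

lemma global_smooth:
  "norm (grad (global_loss m n loss) w - grad (global_loss m n loss) v) \<le> L * infnorm (w - v)"
proof -
  have "norm (\<Sum>i<m. grad (local_loss n loss i) w - grad (local_loss n loss i) v)
      \<le> (\<Sum>i<m. L * infnorm (w - v))"
    by (rule sum_norm_le) (use local_smooth in auto)
  then have "norm (\<Sum>i<m. grad (local_loss n loss i) w - grad (local_loss n loss i) v) / m
      \<le> L * infnorm (w - v)"
    using m_pos by (simp add: field_simps)
  then show ?thesis
    by (simp add: grad_global flip: scaleR_diff_right sum_subtractf)
qed

lemma global_descent:
  "global_loss m n loss v \<le> global_loss m n loss w
     + inner (grad (global_loss m n loss) w) (v - w) + L / 2 * (norm (v - w))\<^sup>2"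
proof (rule descent_lemma)
  show "GDERIV (global_loss m n loss) x :> grad (global_loss m n loss) x" for x
    using GDERIV_global grad_global by metis
  \<comment> \<open>The sup norm is at most the Euclidean norm, so mixed smoothness implies the
    usual Lipschitz condition.\<close>
  show "norm (grad (global_loss m n loss) x - grad (global_loss m n loss) y) \<le> L * norm (x - y)" for x y
    using global_smooth[of x y] infnorm_le_norm[of "x - y"] L_pos
    by (meson mult_left_mono order.trans less_imp_le)
qed

text \<open>A gradient step of length \<open>1 / L\<close> lowers the loss by at least the squared
  gradient norm over \<open>2 * L\<close>, yet cannot pass the infimum. Against the P.L. condition
  this yields \<open>\<mu> \<le> L\<close> as soon as some gap is positive.\<close>

lemma gap_le_smooth:
  assumes "bdd_below (range (global_loss m n loss))"
  shows "(norm (grad (global_loss m n loss) w))\<^sup>2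
      \<le> 2 * L * (global_loss m n loss w - (INF v. global_loss m n loss v))"
proof -
  let ?g = "grad (global_loss m n loss) w"
  have "(INF v. global_loss m n loss v) \<le> global_loss m n loss (w - (1 / L) *\<^sub>R ?g)"
    by (rule cINF_lower[OF assms]) simp
  also have "\<dots> \<le> global_loss m n loss w - (norm ?g)\<^sup>2 / (2 * L)"
    using global_descent[of "w - (1 / L) *\<^sub>R ?g" w] L_pos
    by (simp add: power2_eq_square power2_norm_eq_inner[symmetric] field_simps)
  finally show ?thesis using L_pos by (simp add: field_simps)
qed

section \<open>Centred gradients and their prefix sums\<close>

definition dev :: "nat \<Rightarrow> nat \<Rightarrow> 'a \<Rightarrow> 'a" where
  "dev i e w = grad (loss i e) w - grad (local_loss n loss i) w"

definition orders :: "(nat \<Rightarrow> nat list) \<Rightarrow> bool" where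
  "orders \<pi> \<longleftrightarrow> (\<forall>i<m. \<pi> i \<in> permutations_of_set {..<n})"

text \<open>All gradients are taken at the one point \<open>w\<close>, so the drift within the epoch
  does not enter. The sup norm is the one in which balancing is guaranteed and smoothness is
  assumed.\<close>

definition prefix_bounded :: "'a \<Rightarrow> (nat \<Rightarrow> nat list) \<Rightarrow> real \<Rightarrow> bool" where
  "prefix_bounded w \<pi> S \<longleftrightarrow> (\<forall>k\<le>n. infnorm (\<Sum>j<k. \<Sum>i<m. dev i (\<pi> i ! j) w) \<le> S)"

lemma norm_dev: "i < m \<Longrightarrow> e < n \<Longrightarrow> norm (dev i e w) \<le> \<sigma>"
  unfolding dev_def using variance[of i e w] \<sigma>_pos by (simp add: power2_le_iff_abs_le)

lemma norm_dev_diff: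
  assumes "i < m" and "e < n"
  shows "norm (dev i e w - dev i e v) \<le> 2 * L * infnorm (w - v)"
proof -
  have "dev i e w - dev i e v = (grad (loss i e) w - grad (loss i e) v)
      - (grad (local_loss n loss i) w - grad (local_loss n loss i) v)"
    by (simp add: dev_def)
  then show ?thesis
    using smooth[OF assms, of w v] local_smooth[OF assms(1), of w v]
      norm_triangle_ineq4[of "grad (loss i e) w - grad (loss i e) v"
        "grad (local_loss n loss i) w - grad (local_loss n loss i) v"] by simp
qed

lemma orders_less: "orders \<pi> \<Longrightarrow> i < m \<Longrightarrow> j < n \<Longrightarrow> \<pi> i ! j < n"
  unfolding orders_def using nth_permutation_less by blast

lemma orders_reorder: "orders \<pi> \<Longrightarrow> orders (reorder m n ss \<pi>)"
  unfolding orders_def using reorder_permutation by blast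

text \<open>A full pass visits every example once, and centring at the worker's own mean makes the
  deviations cancel. This turns suffix sums into prefix sums and identifies the global gradient with
  an epoch average.\<close>

lemma sum_dev_orders:
  assumes "orders \<pi>"
  shows "(\<Sum>j<n. \<Sum>i<m. dev i (\<pi> i ! j) w) = 0"
proof -
  have "(\<Sum>j<n. dev i (\<pi> i ! j) w) = 0" if "i < m" for i
  proof -
    have "(\<Sum>j<n. dev i (\<pi> i ! j) w) = (\<Sum>e<n. dev i e w)"
      using assms that unfolding orders_def by (intro sum_nth_permutation) auto
    also have "\<dots> = 0"
      using n_pos by (simp add: dev_def sum_subtractf grad_local[OF that] sum_constant_scaleR)
    finally show ?thesis .
  qed
  then have "(\<Sum>i<m. \<Sum>j<n. dev i (\<pi> i ! j) w) = 0" by simp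
  then show ?thesis by (subst sum.swap)
qed

section \<open>Drift and descent within an epoch\<close>

text \<open>If all earlier iterates are within \<open>D\<close> of \<open>w\<close>, each gradient
  used so far is within \<open>L * D\<close> of its value at \<open>w\<close>. The hypothesis on
  \<open>D\<close> says that the displacement estimate obtained from this does not exceed
  \<open>D\<close>, which closes the induction.\<close>

lemma inner_iterate_close:
  fixes \<alpha> :: real
  assumes \<pi>: "orders \<pi>" and S: "prefix_bounded w \<pi> S" and \<alpha>: "\<alpha> \<ge> 0" "\<alpha> * n * L < 1"
    and D: "\<alpha> * S / m + \<alpha> * n * norm (grad (global_loss m n loss) w) + \<alpha> * n * L * D \<le> D"
    and "k \<le> n"
  shows "infnorm (inner_iterate m loss \<alpha> w \<pi> k - w) \<le> D"
  using \<open>k \<le> n\<close>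
proof (induction k rule: less_induct)
  case (less k)
  define x where "x = inner_iterate m loss \<alpha> w \<pi>"
  let ?G = "grad (global_loss m n loss) w"
  define err where "err j i = grad (loss i (\<pi> i ! j)) (x j) - grad (loss i (\<pi> i ! j)) w" for j i
  have "0 \<le> S" using S infnorm_pos_le order.trans unfolding prefix_bounded_def by blast
  then have "0 \<le> (1 - \<alpha> * n * L) * D"
    using D \<alpha> by (simp add: algebra_simps) (smt (verit) mult_nonneg_nonneg norm_ge_zero of_nat_0_le_iff divide_nonneg_nonneg)
  then have "0 \<le> D" using \<alpha> by (simp add: zero_le_mult_iff)
  have err: "norm (err j i) \<le> L * D" if "j < k" "i < m" for j i
  proof -
    have "norm (err j i) \<le> L * infnorm (x j - w)"
      unfolding err_def by (intro smooth orders_less[OF \<pi>]) (use that less.prems in auto)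
    also have "\<dots> \<le> L * D"
      using less.IH[of j] that less.prems L_pos by (simp add: x_def)
    finally show ?thesis .
  qed
  have step: "x k - w = - ((\<alpha> / m) *\<^sub>R (\<Sum>j<k. \<Sum>i<m. grad (loss i (\<pi> i ! j)) (x j)))"
    unfolding x_def by (rule inner_iterate_diff)
  \<comment> \<open>Each gradient splits into its deviation at \<open>w\<close>, the local mean and
    the error of moving from \<open>w\<close> to \<open>x j\<close>; the local means add up to
    \<open>m\<close> times the global gradient.\<close>
  have "(\<Sum>i<m. grad (loss i (\<pi> i ! j)) (x j)) = (\<Sum>i<m. dev i (\<pi> i ! j) w) + real m *\<^sub>R ?G + (\<Sum>i<m. err j i)" for j
    using m_pos by (simp add: grad_global dev_def err_def sum_subtractf)
  then have "(\<Sum>j<k. \<Sum>i<m. grad (loss i (\<pi> i ! j)) (x j)) =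
      (\<Sum>j<k. \<Sum>i<m. dev i (\<pi> i ! j) w) + ((real k * real m) *\<^sub>R ?G + (\<Sum>j<k. \<Sum>i<m. err j i))"
    by (simp add: sum.distrib sum_constant_scaleR)
  moreover have "infnorm (\<Sum>j<k. \<Sum>i<m. dev i (\<pi> i ! j) w) \<le> S"
    using S less.prems unfolding prefix_bounded_def by blast
  moreover have "infnorm ((real k * real m) *\<^sub>R ?G) \<le> real k * real m * norm ?G"
    using infnorm_le_norm[of "(real k * real m) *\<^sub>R ?G"] by simp
  moreover have "infnorm (\<Sum>j<k. \<Sum>i<m. err j i) \<le> real k * real m * (L * D)"
    by (rule order.trans[OF infnorm_le_norm norm_double_sum_le]) (use err in auto)
  ultimately have "infnorm (\<Sum>j<k. \<Sum>i<m. grad (loss i (\<pi> i ! j)) (x j))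
      \<le> S + (real k * real m * norm ?G + real k * real m * (L * D))"
    by (smt (verit) infnorm_triangle)
  then have "infnorm (x k - w) \<le> \<alpha> / m * (S + (real k * real m * norm ?G + real k * real m * (L * D)))"
    unfolding step infnorm_neg infnorm_mul using \<alpha> by (simp add: mult_left_mono divide_right_mono)
  also have "\<dots> = \<alpha> * S / m + \<alpha> * k * (norm ?G + L * D)"
    using m_pos by (simp add: field_simps)
  also have "\<dots> \<le> \<alpha> * S / m + \<alpha> * n * (norm ?G + L * D)"
    using \<alpha> less.prems L_pos \<open>0 \<le> D\<close> by (intro add_left_mono mult_right_mono mult_left_mono) auto
  also have "\<dots> \<le> D" using D by (simp add: algebra_simps)
  finally show ?case by (simp add: x_def)
qed

text \<open>The epoch is a single step of length \<open>\<alpha> * n\<close> along the averaged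
  gradient \<open>H\<close>, which differs from the true gradient \<open>G\<close> by at most
  \<open>L * D\<close>.\<close>

lemma epoch_descent:
  fixes \<alpha> :: real
  assumes \<pi>: "orders \<pi>" and \<alpha>: "\<alpha> > 0" "\<alpha> * n * L \<le> 1"
    and D: "\<And>k. k \<le> n \<Longrightarrow> infnorm (inner_iterate m loss \<alpha> w \<pi> k - w) \<le> D"
  shows "global_loss m n loss (inner_iterate m loss \<alpha> w \<pi> n) \<le> global_loss m n loss w
     - \<alpha> * n / 2 * (norm (grad (global_loss m n loss) w))\<^sup>2 + \<alpha> * n / 2 * L\<^sup>2 * D\<^sup>2"
proof -
  define x where "x = inner_iterate m loss \<alpha> w \<pi>"
  define G where "G = grad (global_loss m n loss) w"
  define N where "N = real n * real m"
  define H where "H = (1 / N) *\<^sub>R (\<Sum>j<n. \<Sum>i<m. grad (loss i (\<pi> i ! j)) (x j))"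
  have N: "N > 0" using m_pos n_pos by (simp add: N_def)
  have step: "x n - w = - ((\<alpha> * n) *\<^sub>R H)"
    using n_pos unfolding x_def inner_iterate_diff by (simp add: H_def N_def x_def)
  \<comment> \<open>Since the deviations cancel, \<open>G\<close> is the average of the same
    gradients in the same order, taken at \<open>w\<close>; so \<open>H - G\<close> is an average of
    drift errors.\<close>
  have "(\<Sum>j<n. \<Sum>i<m. grad (loss i (\<pi> i ! j)) w) =
      (\<Sum>j<n. \<Sum>i<m. dev i (\<pi> i ! j) w) + (\<Sum>j<n. \<Sum>i<m. grad (local_loss n loss i) w)"
    by (simp add: dev_def flip: sum.distrib)
  also have "\<dots> = N *\<^sub>R G"
    using sum_dev_orders[OF \<pi>] m_pos
    by (simp add: G_def grad_global N_def sum_constant_scaleR)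
  finally have "G = (1 / N) *\<^sub>R (\<Sum>j<n. \<Sum>i<m. grad (loss i (\<pi> i ! j)) w)"
    using N by simp
  then have "H - G = (1 / N) *\<^sub>R (\<Sum>j<n. \<Sum>i<m. grad (loss i (\<pi> i ! j)) (x j) - grad (loss i (\<pi> i ! j)) w)"
    by (simp add: H_def sum_subtractf scaleR_diff_right)
  moreover have "norm (\<Sum>j<n. \<Sum>i<m. grad (loss i (\<pi> i ! j)) (x j) - grad (loss i (\<pi> i ! j)) w) \<le> N * (L * D)"
    unfolding N_def
  proof (rule norm_double_sum_le)
    fix j i assume ji: "j < n" "i < m"
    have "norm (grad (loss i (\<pi> i ! j)) (x j) - grad (loss i (\<pi> i ! j)) w) \<le> L * infnorm (x j - w)"
      by (intro smooth orders_less[OF \<pi>] ji)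
    also have "\<dots> \<le> L * D" using D[of j] ji L_pos by (simp add: x_def)
    finally show "norm (grad (loss i (\<pi> i ! j)) (x j) - grad (loss i (\<pi> i ! j)) w) \<le> L * D" .
  qed
  ultimately have "norm (H - G) \<le> L * D" using N by (simp add: field_simps)
  then have HG: "(norm (H - G))\<^sup>2 \<le> L\<^sup>2 * D\<^sup>2"
    by (metis norm_ge_zero power_mono power_mult_distrib)
  have cross: "2 * inner G H = (norm G)\<^sup>2 + (norm H)\<^sup>2 - (norm (H - G))\<^sup>2"
    by (simp add: power2_norm_eq_inner inner_diff_left inner_diff_right inner_commute)
  have "global_loss m n loss (x n) \<le> global_loss m n loss w + inner G (x n - w) + L / 2 * (norm (x n - w))\<^sup>2"
    unfolding G_def by (rule global_descent)
  also have "\<dots> = global_loss m n loss w - \<alpha> * n / 2 * (2 * inner G H) + \<alpha> * n / 2 * ((\<alpha> * n * L) * (norm H)\<^sup>2)"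
    unfolding step by (simp add: power_mult_distrib power2_eq_square)
  \<comment> \<open>As \<open>\<alpha> * n * L \<le> 1\<close>, the quadratic term is at most what
    the polarization identity \<open>cross\<close> removes, and the norm of \<open>H\<close> drops
    out.\<close>
  also have "\<dots> \<le> global_loss m n loss w - \<alpha> * n / 2 * (2 * inner G H) + \<alpha> * n / 2 * (1 * (norm H)\<^sup>2)"
    using \<alpha> by (intro add_left_mono mult_left_mono mult_right_mono) auto
  also have "\<dots> = global_loss m n loss w - \<alpha> * n / 2 * (norm G)\<^sup>2 + \<alpha> * n / 2 * (norm (H - G))\<^sup>2"
    unfolding cross by (simp add: algebra_simps)
  also have "\<dots> \<le> global_loss m n loss w - \<alpha> * n / 2 * (norm G)\<^sup>2 + \<alpha> * n / 2 * (L\<^sup>2 * D\<^sup>2)"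
    using \<alpha> HG by (intro add_left_mono mult_left_mono) auto
  finally show ?thesis by (simp add: x_def G_def)
qed


section \<open>Effect of balanced signs on the next order\<close>

definition good_signs :: "real \<Rightarrow> 'a list \<Rightarrow> bool list \<Rightarrow> bool" where
  "good_signs A cs ss \<longleftrightarrow> (\<forall>k\<in>{1..length cs}.
     infnorm (\<Sum>j<k. sign_val (ss ! j) *\<^sub>R cs ! j) \<le> A * Max (norm ` set cs))"

text \<open>Workers form the inner loop of the feeding, so the first \<open>k\<close> pairs of all
  workers are the first \<open>k * m\<close> vectors fed, and the balancing bound applies to that
  prefix.\<close>

lemma signed_sum_pair_diffs:
  assumes good: "good_signs A (pair_diffs m n loss \<alpha> w \<pi>) ss" and "A \<ge> 0" and k: "2 * k \<le> n"
    and C: "0 \<le> C" "\<And>i l. i < m \<Longrightarrow> 2 * l + 1 < n \<Longrightarrow>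
      norm (epoch_grad m loss \<alpha> w \<pi> i (2 * l) - epoch_grad m loss \<alpha> w \<pi> i (2 * l + 1)) \<le> C"
  shows "infnorm (\<Sum>l<k. \<Sum>i<m. sign_val (ss ! (l * m + i)) *\<^sub>R
           (epoch_grad m loss \<alpha> w \<pi> i (2 * l) - epoch_grad m loss \<alpha> w \<pi> i (2 * l + 1))) \<le> A * C"
proof (cases "k = 0")
  case True
  then show ?thesis using assms by (simp add: infnorm_0)
next
  case False
  define cs where "cs = pair_diffs m n loss \<alpha> w \<pi>"
  define c where "c l i = epoch_grad m loss \<alpha> w \<pi> i (2 * l) - epoch_grad m loss \<alpha> w \<pi> i (2 * l + 1)" for l i
  have cs: "cs = concat (map (\<lambda>l. map (c l) [0..<m]) [0..<n div 2])"
    by (simp add: cs_def pair_diffs_def c_def[abs_def])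
  have len: "length cs = n div 2 * m"
    unfolding cs by (simp add: length_concat comp_def sum_list_triv)
  have nth: "cs ! (l * m + i) = c l i" if "l < k" "i < m" for l i
    unfolding cs using that k by (intro nth_concat_map_upt) auto
  have "(\<Sum>l<k. \<Sum>i<m. sign_val (ss ! (l * m + i)) *\<^sub>R c l i)
      = (\<Sum>l<k. \<Sum>i<m. sign_val (ss ! (l * m + i)) *\<^sub>R cs ! (l * m + i))"
    using nth by simp
  also have "\<dots> = (\<Sum>l<k. \<Sum>j\<in>{l * m..<l * m + m}. sign_val (ss ! j) *\<^sub>R cs ! j)"
    by (rule sum.cong[OF refl], subst add.commute, subst (2) add_0[of "_ * m", symmetric],
        subst sum.shift_bounds_nat_ivl) (simp add: lessThan_atLeast0 add.commute)
  also have "\<dots> = (\<Sum>j<k * m. sign_val (ss ! j) *\<^sub>R cs ! j)"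
    by (rule sum.nat_group)
  finally have eq: "(\<Sum>l<k. \<Sum>i<m. sign_val (ss ! (l * m + i)) *\<^sub>R c l i)
      = (\<Sum>j<k * m. sign_val (ss ! j) *\<^sub>R cs ! j)" .
  have "k \<le> n div 2" using k by simp
  then have "k * m \<le> length cs" unfolding len by (rule mult_le_mono1)
  \<comment> \<open>The guarantee covers nonempty prefixes only, hence the separate case
    \<open>k = 0\<close>.\<close>
  then have km: "k * m \<in> {1..length cs}" using False m_pos by simp
  then have "set cs \<noteq> {}" by auto
  moreover have "norm x \<le> C" if "x \<in> set cs" for x
  proof -
    have "\<exists>l<n div 2. \<exists>i<m. x = c l i" using that unfolding cs by auto blast
    then obtain l i where "l < n div 2" "i < m" "x = c l i" by blast
    then show ?thesis using C(2)[of i l] by (simp add: c_def)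
  qed
  ultimately have "Max (norm ` set cs) \<le> C" by simp
  then have "A * Max (norm ` set cs) \<le> A * C" using \<open>A \<ge> 0\<close> by (rule mult_left_mono)
  then have "infnorm (\<Sum>j<k * m. sign_val (ss ! j) *\<^sub>R cs ! j) \<le> A * C"
    using good[unfolded good_signs_def, folded cs_def] km order.trans by blast
  then show ?thesis using eq by (simp add: c_def)
qed

text \<open>Of each pair, one member goes to the front half of the new order and the other to the back
  half; writing the chosen member as half of sum plus or minus difference expresses the new prefix
  sums by the old prefix sums and the signed sums of the pair differences.\<close>

lemma prefix_reorder:
  fixes \<alpha> :: real
  assumes \<pi>: "orders \<pi>" and S: "prefix_bounded w \<pi> S" and "A \<ge> 0"
    and good: "good_signs A (pair_diffs m n loss \<alpha> w \<pi>) ss"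
    and D: "\<And>k. k \<le> n \<Longrightarrow> infnorm (inner_iterate m loss \<alpha> w \<pi> k - w) \<le> D"
  shows "prefix_bounded (inner_iterate m loss \<alpha> w \<pi> n) (reorder m n ss \<pi>)
           (S / 2 + A * (\<sigma> + L * D) + 3 / 2 * (real n * real m * (L * D)))"
    (is "prefix_bounded ?w' ?\<pi>' ?S'")
proof -
  define h where "h = n div 2"
  have n: "n = 2 * h" using even_n by (simp add: h_def)
  define x where "x = inner_iterate m loss \<alpha> w \<pi>"
  define a where "a i j = dev i (\<pi> i ! j) w" for i j
  define b where "b i j = epoch_grad m loss \<alpha> w \<pi> i j" for i j
  define s where "s l i = sign_val (ss ! (l * m + i))" for l i
  have "0 \<le> D" using D[of 0] infnorm_pos_le[of "0::'a"] by (simp add: infnorm_0)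
  then have LD: "0 \<le> L * D" using L_pos by simp
  have close: "norm (b i j - grad (loss i (\<pi> i ! j)) w) \<le> L * D" if "i < m" "j < n" for i j
  proof -
    have "norm (b i j - grad (loss i (\<pi> i ! j)) w) \<le> L * infnorm (x j - w)"
      unfolding b_def epoch_grad_def x_def by (intro smooth orders_less[OF \<pi>] that)
    also have "\<dots> \<le> L * D" using D[of j] that L_pos by (simp add: x_def)
    finally show ?thesis .
  qed
  \<comment> \<open>The local mean cancels in a difference within one worker, so only the drift
    separates centred differences at \<open>w\<close> from the differences actually fed.\<close>
  have dist: "norm ((a i j - a i j') - (b i j - b i j')) \<le> 2 * (L * D)"
    if "i < m" "j < n" "j' < n" for i j j'
  proof -
    have "(a i j - a i j') - (b i j - b i j') =
        (b i j' - grad (loss i (\<pi> i ! j')) w) - (b i j - grad (loss i (\<pi> i ! j)) w)"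
      by (simp add: a_def dev_def)
    then have "norm ((a i j - a i j') - (b i j - b i j')) =
        norm ((b i j' - grad (loss i (\<pi> i ! j')) w) - (b i j - grad (loss i (\<pi> i ! j)) w))"
      by (rule arg_cong)
    then show ?thesis using close[OF that(1,2)] close[OF that(1,3)]
      norm_triangle_ineq4[of "b i j' - grad (loss i (\<pi> i ! j')) w" "b i j - grad (loss i (\<pi> i ! j)) w"]
      by linarith
  qed
  have pair: "norm (b i j - b i j') \<le> 2 * (\<sigma> + L * D)" if "i < m" "j < n" "j' < n" for i j j'
  proof -
    have "norm (a i j - a i j') \<le> 2 * \<sigma>"
      using norm_triangle_ineq4[of "a i j" "a i j'"] that orders_less[OF \<pi>]
        norm_dev[of i "\<pi> i ! j" w] norm_dev[of i "\<pi> i ! j'" w] by (simp add: a_def)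
    then show ?thesis
      using dist[OF that] norm_triangle_ineq2[of "b i j - b i j'" "a i j - a i j'"]
      by (simp add: norm_minus_commute)
  qed
  have count: "real k * real m * (2 * (L * D)) \<le> real n * real m * (L * D)" if "k \<le> h" for k
  proof -
    have "real (2 * k) * (real m * (L * D)) \<le> real n * (real m * (L * D))"
      using that n LD by (intro mult_right_mono) auto
    then show ?thesis by (simp add: mult_ac)
  qed
  have signed: "infnorm (\<Sum>l<k. \<Sum>i<m. s l i *\<^sub>R (a i (2 * l) - a i (2 * l + 1)))
      \<le> 2 * (A * (\<sigma> + L * D)) + real n * real m * (L * D)" if k: "k \<le> h" for k
  proof -
    have "infnorm (\<Sum>l<k. \<Sum>i<m. s l i *\<^sub>R (b i (2 * l) - b i (2 * l + 1))) \<le> A * (2 * (\<sigma> + L * D))"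
      unfolding s_def b_def
      by (rule signed_sum_pair_diffs[OF good \<open>A \<ge> 0\<close>])
        (use k n LD \<sigma>_pos pair[unfolded b_def] in auto)
    moreover have "norm (\<Sum>l<k. \<Sum>i<m. s l i *\<^sub>R ((a i (2 * l) - a i (2 * l + 1)) - (b i (2 * l) - b i (2 * l + 1))))
        \<le> real k * real m * (2 * (L * D))"
      by (rule norm_double_sum_le) (use k n dist in \<open>auto simp: s_def sign_val_def\<close>)
    moreover note count[OF k]
    ultimately show ?thesis
      using infnorm_minus_le[of "\<Sum>l<k. \<Sum>i<m. s l i *\<^sub>R (a i (2 * l) - a i (2 * l + 1))"
          "\<Sum>l<k. \<Sum>i<m. s l i *\<^sub>R (b i (2 * l) - b i (2 * l + 1))"]
        infnorm_le_norm[of "\<Sum>l<k. \<Sum>i<m. s l i *\<^sub>R ((a i (2 * l) - a i (2 * l + 1)) - (b i (2 * l) - b i (2 * l + 1)))"]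
      by (simp add: sum_subtractf scaleR_diff_right distrib_left)
  qed
  \<comment> \<open>\<open>c = True\<close> describes the front half and \<open>c = False\<close>
    the back half read from the end. The drift costs half of \<open>n * m * L * D\<close> in
    replacing the fed differences and a full one in moving from \<open>w\<close> to the new weights,
    hence 3/2.\<close>
  have half: "infnorm (\<Sum>l<k. \<Sum>i<m. dev i (\<pi> i ! (if ss ! (l * m + i) = c then 2 * l else 2 * l + 1)) ?w')
      \<le> ?S'" if k: "k \<le> h" for k c
  proof -
    define p where "p l i = (if ss ! (l * m + i) = c then 2 * l else 2 * l + 1)" for l i
    have "a i (p l i) = (1 / 2) *\<^sub>R ((a i (2 * l) + a i (2 * l + 1))
        + sign_val c *\<^sub>R s l i *\<^sub>R (a i (2 * l) - a i (2 * l + 1)))" for l i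
      by (cases c; cases "ss ! (l * m + i)")
        (simp_all add: p_def s_def sign_val_def scaleR_add_left[symmetric] scaleR_add_right[symmetric])
    moreover define X where "X = (\<Sum>j<2 * k. \<Sum>i<m. a i j)"
    moreover define Y where
      "Y = sign_val c *\<^sub>R (\<Sum>l<k. \<Sum>i<m. s l i *\<^sub>R (a i (2 * l) - a i (2 * l + 1)))"
    ultimately have "(\<Sum>l<k. \<Sum>i<m. a i (p l i)) = (1 / 2) *\<^sub>R (X + Y)"
      by (simp add: sum_lessThan_double sum.distrib scaleR_sum_right scaleR_add_right)
    then have "infnorm (\<Sum>l<k. \<Sum>i<m. a i (p l i)) = infnorm (X + Y) / 2"
      by (simp add: infnorm_mul)
    moreover have "infnorm X \<le> S"
      using S k n unfolding prefix_bounded_def a_def X_def by simp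
    moreover have "infnorm Y \<le> 2 * (A * (\<sigma> + L * D)) + real n * real m * (L * D)"
      using signed[OF k] unfolding Y_def infnorm_mul by (simp add: sign_val_def)
    ultimately have old: "infnorm (\<Sum>l<k. \<Sum>i<m. a i (p l i))
        \<le> S / 2 + A * (\<sigma> + L * D) + real n * real m * (L * D) / 2"
      using infnorm_triangle[of X Y] by linarith
    have "norm (\<Sum>l<k. \<Sum>i<m. dev i (\<pi> i ! p l i) ?w' - a i (p l i)) \<le> real k * real m * (2 * (L * D))"
    proof (rule norm_double_sum_le)
      fix l i assume "l < k" "i < m"
      then have "p l i < n" using k n by (auto simp: p_def)
      then have "norm (dev i (\<pi> i ! p l i) ?w' - a i (p l i)) \<le> 2 * L * infnorm (?w' - w)"
        unfolding a_def using \<open>i < m\<close> by (intro norm_dev_diff orders_less[OF \<pi>])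
      also have "\<dots> \<le> 2 * L * D" using D[of n] L_pos by simp
      finally show "norm (dev i (\<pi> i ! p l i) ?w' - a i (p l i)) \<le> 2 * (L * D)" by simp
    qed
    also have "\<dots> \<le> real n * real m * (L * D)"
      by (rule count[OF k])
    finally show ?thesis
      using old infnorm_minus_le[of "\<Sum>l<k. \<Sum>i<m. dev i (\<pi> i ! p l i) ?w'" "\<Sum>l<k. \<Sum>i<m. a i (p l i)"]
        infnorm_le_norm[of "\<Sum>l<k. \<Sum>i<m. dev i (\<pi> i ! p l i) ?w' - a i (p l i)"]
      by (simp add: sum_subtractf p_def)
  qed
  show ?thesis
    unfolding prefix_bounded_def
  proof (intro allI impI)
    fix k assume "k \<le> n"
    show "infnorm (\<Sum>j<k. \<Sum>i<m. dev i (?\<pi>' i ! j) ?w') \<le> ?S'"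
    proof (cases "k \<le> h")
      case True
      then show ?thesis using half[of k True] nth_reorder_front[OF n] by simp
    next
      \<comment> \<open>Beyond the middle, the prefix sum is minus the remaining suffix sum, because
        the total vanishes; that suffix has at most \<open>h\<close> terms.\<close>
      case False
      define k' where "k' = n - k"
      have k': "k' \<le> h" "k = n - k'" "k' \<le> n" using False n \<open>k \<le> n\<close> by (auto simp: k'_def)
      let ?f = "\<lambda>j. \<Sum>i<m. dev i (?\<pi>' i ! j) ?w'"
      have "0 = (\<Sum>j<n. ?f j)"
        using sum_dev_orders[OF orders_reorder[OF \<pi>]] by simp
      also have "\<dots> = (\<Sum>j<k. ?f j) + (\<Sum>j\<in>{k..<n}. ?f j)"
        using \<open>k \<le> n\<close> by (simp add: lessThan_atLeast0 sum.atLeastLessThan_concat)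
      also have "(\<Sum>j\<in>{k..<n}. ?f j) = (\<Sum>l<k'. ?f (n - 1 - l))"
        by (rule sum.reindex_bij_witness[of _ "\<lambda>l. n - 1 - l" "\<lambda>j. n - 1 - j"]) (use k' in auto)
      also have "\<dots> = (\<Sum>l<k'. \<Sum>i<m. dev i (\<pi> i ! (if ss ! (l * m + i) = False then 2 * l else 2 * l + 1)) ?w')"
        using nth_reorder_back[OF n] k' by (intro sum.cong refl) auto
      finally have "(\<Sum>j<k. ?f j) = - (\<Sum>l<k'. \<Sum>i<m. dev i (\<pi> i ! (if ss ! (l * m + i) = False then 2 * l else 2 * l + 1)) ?w')"
        by (simp add: eq_neg_iff_add_eq_0)
      then show ?thesis using half[OF k'(1), of False] by (simp only: infnorm_neg)
    qed
  qed
qed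

lemma prefix_bounded_initial:
  assumes "orders \<pi>"
  shows "prefix_bounded w \<pi> (real n * real m * \<sigma>)"
  unfolding prefix_bounded_def
proof (intro allI impI)
  fix k assume k: "k \<le> n"
  have "norm (\<Sum>j<k. \<Sum>i<m. dev i (\<pi> i ! j) w) \<le> real k * real m * \<sigma>"
    by (rule norm_double_sum_le) (use k norm_dev orders_less[OF assms] in auto)
  also have "\<dots> \<le> real n * real m * \<sigma>" using k \<sigma>_pos by (intro mult_right_mono) auto
  finally show "infnorm (\<Sum>j<k. \<Sum>i<m. dev i (\<pi> i ! j) w) \<le> real n * real m * \<sigma>"
    using infnorm_le_norm order.trans by blast
qed


section \<open>Contraction of the potential and convergence over all epochs\<close>

lemma lyapunov_step:
  fixes \<alpha> :: real
  assumes \<pi>: "orders \<pi>" and S: "prefix_bounded w \<pi> S" "0 \<le> S" and pos: "0 \<le> A" "\<alpha> > 0"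
    and small: "2 * (\<alpha> * n * L) + \<alpha> * A * L / m \<le> 1 / 16" and "\<mu> \<le> L"
    and PL: "1 / 2 * (norm (grad (global_loss m n loss) w))\<^sup>2 \<ge> \<mu> * (global_loss m n loss w - c)"
    and good: "good_signs A (pair_diffs m n loss \<alpha> w \<pi>) ss"
  obtains S' where "0 \<le> S'" and "prefix_bounded (inner_iterate m loss \<alpha> w \<pi> n) (reorder m n ss \<pi>) S'"
    and "global_loss m n loss (inner_iterate m loss \<alpha> w \<pi> n) - c + 7 / 2 * (\<alpha> * n) * L\<^sup>2 * (\<alpha> * S' / m)\<^sup>2
      \<le> (1 - \<alpha> * n * \<mu> / 2) * (global_loss m n loss w - c + 7 / 2 * (\<alpha> * n) * L\<^sup>2 * (\<alpha> * S / m)\<^sup>2)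
        + 14 * (\<alpha> * n) * L\<^sup>2 * (\<alpha> * A * \<sigma> / m)\<^sup>2"
proof -
  define G where "G = norm (grad (global_loss m n loss) w)"
  \<comment> \<open>The exact solution of the self-consistency condition for the drift
    bound.\<close>
  define D where "D = (\<alpha> * S / m + \<alpha> * n * G) / (1 - \<alpha> * n * L)"
  have "0 \<le> \<alpha> * A * L / m" using pos L_pos by simp
  then have \<alpha>L: "\<alpha> * n * L \<le> 1 / 32" using small by linarith
  then have D: "\<alpha> * S / m + \<alpha> * n * G + \<alpha> * n * L * D = D"
  proof -
    have "D * (1 - \<alpha> * n * L) = \<alpha> * S / m + \<alpha> * n * G" using \<alpha>L by (simp add: D_def)
    then show ?thesis by (simp add: algebra_simps)
  qed
  have close: "infnorm (inner_iterate m loss \<alpha> w \<pi> k - w) \<le> D" if "k \<le> n" for k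
    by (rule inner_iterate_close[OF \<pi> S(1)]) (use pos \<alpha>L D that in \<open>auto simp: G_def\<close>)
  then have "0 \<le> D" using infnorm_pos_le order.trans by blast
  define S' where "S' = S / 2 + A * (\<sigma> + L * D) + 3 / 2 * (real n * real m * (L * D))"
  show ?thesis
  proof (rule that)
    show S': "0 \<le> S'" using S pos \<open>0 \<le> D\<close> L_pos \<sigma>_pos by (simp add: S'_def)
    show "prefix_bounded (inner_iterate m loss \<alpha> w \<pi> n) (reorder m n ss \<pi>) S'"
      unfolding S'_def by (rule prefix_reorder[OF \<pi> S(1) pos(1) good close])
    show "global_loss m n loss (inner_iterate m loss \<alpha> w \<pi> n) - c + 7 / 2 * (\<alpha> * n) * L\<^sup>2 * (\<alpha> * S' / m)\<^sup>2
      \<le> (1 - \<alpha> * n * \<mu> / 2) * (global_loss m n loss w - c + 7 / 2 * (\<alpha> * n) * L\<^sup>2 * (\<alpha> * S / m)\<^sup>2)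
        + 14 * (\<alpha> * n) * L\<^sup>2 * (\<alpha> * A * \<sigma> / m)\<^sup>2"
    proof (rule lyapunov_arith[where a = "\<alpha> * A * L / m" and G = G and D = D])
      show "global_loss m n loss (inner_iterate m loss \<alpha> w \<pi> n) - c \<le> global_loss m n loss w - c
          - \<alpha> * n / 2 * G\<^sup>2 + \<alpha> * n / 2 * (L\<^sup>2 * D\<^sup>2)"
        using epoch_descent[OF \<pi> pos(2) _ close] \<alpha>L by (simp add: G_def mult.assoc)
      show "\<alpha> * S' / m = \<alpha> * S / m / 2 + \<alpha> * A * \<sigma> / m + (\<alpha> * A * L / m + 3 / 2 * (\<alpha> * n * L)) * D"
        using m_pos by (simp add: S'_def field_simps)
    qed (use S S' pos L_pos n_pos small \<open>\<mu> \<le> L\<close> PL in \<open>auto simp: G_def D_def\<close>)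
  qed
qed

end

theorem theorem3:
  fixes loss :: "nat \<Rightarrow> nat \<Rightarrow> real ^ 'd \<Rightarrow> real"
    and thr :: "(real ^ 'd) list \<Rightarrow> real"
    and w\<^sub>1 :: "real ^ 'd"
    and \<pi>\<^sub>1 :: "nat \<Rightarrow> nat list"
    and m n T :: nat
    and \<alpha> \<delta> \<sigma> \<zeta> L \<mu> F\<^sub>1 A W :: real
  assumes "m > 0" and "n > 0" and "even n"
    and "\<And>i j w. i < m \<Longrightarrow> j < n \<Longrightarrow> loss i j differentiable (at w)"
    and "bdd_below (range (global_loss m n loss))"
    and "\<And>i. i < m \<Longrightarrow> \<pi>\<^sub>1 i \<in> permutations_of_set {..<n}"
    and "\<delta> > 0"
    and "balance_guarantee thr (m * n) \<delta>"
    and "\<sigma> > 0"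
    and "\<And>i j w. i < m \<Longrightarrow> j < n \<Longrightarrow>
           (norm (grad (loss i j) w - grad (local_loss n loss i) w))\<^sup>2 \<le> \<sigma>\<^sup>2"
    and "\<zeta> > 0"
    and "\<And>i w. i < m \<Longrightarrow>
           (norm (grad (local_loss n loss i) w - grad (global_loss m n loss) w))\<^sup>2 \<le> \<zeta>\<^sup>2"
    and "L > 0"
    and "\<And>i j w v. i < m \<Longrightarrow> j < n \<Longrightarrow>
           norm (grad (loss i j) w - grad (loss i j) v) \<le> L * infnorm (w - v)"
    and "\<mu> > 0"
    and "\<And>w. 1 / 2 * (norm (grad (global_loss m n loss) w))\<^sup>2
           \<ge> \<mu> * (global_loss m n loss w - (INF v. global_loss m n loss v))"
    and "F\<^sub>1 = global_loss m n loss w\<^sub>1 - (INF v. global_loss m n loss v)"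
    and "A = balance_const CARD('d) (m * n) \<delta>"
    and "W = W_const F\<^sub>1 \<sigma> \<zeta> L \<mu> A m n T"
    and "\<alpha> = 2 * W / (real T * real n * \<mu>)"
    and "real T \<ge> 10 + 1 / \<mu> * 32 * L * (2 + A / (real m * real n)) * W"
  shows "measure_pmf.prob (cdgrab m n loss thr \<alpha> w\<^sub>1 \<pi>\<^sub>1 T)
           {(w, \<pi>). global_loss m n loss w - (INF v. global_loss m n loss v)
                      \<le> cdgrab_bound F\<^sub>1 \<sigma> \<zeta> L \<mu> A m n T}
           \<ge> 1 - real T * \<delta>
    \<and> (\<lambda>(m', n', T', d', \<delta>').
          cdgrab_bound F\<^sub>1 \<sigma> \<zeta> L \<mu> (balance_const d' (m' * n') \<delta>') m' n' T')
        \<in> soft_bigo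
            (principal {(m', n', T', d', \<delta>').
               m' > 0 \<and> n' > 0 \<and> T' > 0 \<and> d' > 0 \<and> 0 < \<delta>' \<and> \<delta>' < 1})
            (\<lambda>(m', n', T', d', \<delta>').
               ln (4 * real m' * real n' * real T' * real d' / \<delta>'))
            (\<lambda>(m', n', T', d', \<delta>'). 1 / (real m' * real n' * real T')\<^sup>2)"
proof -
  define f where "f = global_loss m n loss"
  define c where "c = (INF v. f v)"
  have bdd: "bdd_below (range f)" using assms(5) by (simp add: f_def)
  have c_le: "c \<le> f w" for w unfolding c_def by (rule cINF_lower[OF bdd]) simp
  have F\<^sub>1: "F\<^sub>1 = f w\<^sub>1 - c" "0 \<le> F\<^sub>1" using assms(17) c_le[of w\<^sub>1] by (simp_all add: f_def c_def)
  interpret cdgrab_losses m n loss L \<sigma> by unfold_locales (use assms in auto)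
  \<comment> \<open>For \<open>T = 0\<close> the Lambert argument is 0, so \<open>W = 0\<close> and
    the requirement on \<open>T\<close> would read \<open>0 \<ge> 10\<close>.\<close>
  have T: "T > 0"
  proof (rule ccontr)
    assume "\<not> T > 0"
    then have "W = 0" using assms(19) by (simp add: W_const_def Lambert_W0_zero)
    then show False using assms(21) \<open>\<not> T > 0\<close> by simp
  qed
  let ?P = "measure_pmf.prob (cdgrab m n loss thr \<alpha> w\<^sub>1 \<pi>\<^sub>1 T)"
  let ?bound = "cdgrab_bound F\<^sub>1 \<sigma> \<zeta> L \<mu> A m n T"
  have "1 - real T * \<delta> \<le> ?P {(w, \<pi>). f w - c \<le> ?bound}"
  proof (cases "\<delta> < 1")
    case False
    then have "1 * 1 \<le> real T * \<delta>" using T by (intro mult_mono) auto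
    then show ?thesis using measure_nonneg[of "measure_pmf (cdgrab m n loss thr \<alpha> w\<^sub>1 \<pi>\<^sub>1 T)"] by (smt (verit))
  next
    case True
    define Q where "Q = F\<^sub>1 + \<sigma>\<^sup>2 / L"
    define C where "C = C3_const F\<^sub>1 \<sigma> \<zeta> L \<mu> A"
    define P where "P = real m * real n * real T"
    have "P > 0" using T m_pos n_pos by (simp add: P_def)
    have "A \<ge> 1" using balance_const_square(2)[of "CARD('d)" "m * n" \<delta>] True assms(7,18) m_pos n_pos by simp
    have "Q > 0" unfolding Q_def using F\<^sub>1(2) \<sigma>_pos L_pos by (intro add_nonneg_pos) auto
    have C: "C > 0" unfolding C_def C3_const_def Q_def[symmetric]
      using \<open>Q > 0\<close> \<open>A \<ge> 1\<close> assms(11,15) \<sigma>_pos L_pos by simp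
    have "W = Lambert_W0 (P\<^sup>2 * C)" using assms(19) by (simp add: W_const_def C_def P_def)
    then have W: "W > 0" "W * exp W = P\<^sup>2 * C" using Lambert_W0[of "P\<^sup>2 * C"] \<open>P > 0\<close> C by simp_all
    have bound: "?bound = 1 / P\<^sup>2 * (Q * W / C + 112 * L\<^sup>2 * (\<zeta> + \<sigma>)\<^sup>2 * A\<^sup>2 * W\<^sup>2 / \<mu> ^ 3)"
      unfolding cdgrab_bound_def by (simp add: P_def Q_def C_def flip: assms(19))
    show ?thesis
    \<comment> \<open>If no gap is positive, nonnegativity of the bound is enough; otherwise a
      positive gap yields \<open>\<mu> \<le> L\<close>.\<close>
    proof (cases "\<exists>w. f w - c > 0")
      case False
      have "0 \<le> ?bound"
        unfolding bound using \<open>Q > 0\<close> W C assms(11,15) \<sigma>_pos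
        by (intro add_nonneg_nonneg divide_nonneg_pos mult_nonneg_nonneg) auto
      then have "f w - c \<le> ?bound" for w using False by (meson not_less order.trans)
      then have "{(w, \<pi> :: nat \<Rightarrow> nat list). f w - c \<le> ?bound} = UNIV" by auto
      then show ?thesis using assms(7) by simp
    next
      case True
      then obtain v where v: "f v - c > 0" by blast
      have "2 * \<mu> * (f v - c) \<le> 2 * L * (f v - c)"
        using gap_le_smooth[OF assms(5), of v] assms(16)[of v] by (simp add: f_def c_def)
      then have "\<mu> \<le> L" using v by simp
      define \<gamma> where "\<gamma> = \<alpha> * n"
      define \<rho> where "\<rho> = \<gamma> * \<mu> / 2"
      define B where "B = \<alpha> * A * \<sigma> / m"
      define K where "K = 14 * \<gamma> * L\<^sup>2 * B\<^sup>2"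
      have "\<alpha> > 0" using assms(15,20) W T n_pos by simp
      have "\<gamma> > 0" using \<open>\<alpha> > 0\<close> n_pos by (simp add: \<gamma>_def)
      have \<rho>T: "\<rho> * T = W" "\<rho> > 0"
        using assms(15,20) T n_pos \<open>\<gamma> > 0\<close> W(1) by (simp_all add: \<rho>_def \<gamma>_def)
      \<comment> \<open>This is the requirement on the number of epochs, rewritten through the
        learning rate.\<close>
      have small: "2 * (\<alpha> * n * L) + \<alpha> * A * L / m \<le> 1 / 16"
      proof -
        have "32 * (L * (2 + A / (real m * real n)) * W) / \<mu> \<le> T" using assms(21) by simp
        then have "2 * (L * (2 + A / (real m * real n)) * W) / (\<mu> * T) \<le> 1 / 16"
          using T assms(15) by (simp add: field_simps)
        moreover have "\<gamma> = 2 * W / (\<mu> * T)"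
          using assms(20) n_pos by (simp add: \<gamma>_def mult.commute)
        moreover have "2 * (\<alpha> * n * L) + \<alpha> * A * L / m = \<gamma> * (L * (2 + A / (real m * real n)))"
          using n_pos m_pos by (simp add: \<gamma>_def field_simps)
        ultimately show ?thesis by (simp add: mult_ac)
      qed
      have "0 \<le> \<alpha> * A * L / m" using \<open>\<alpha> > 0\<close> \<open>A \<ge> 1\<close> L_pos by simp
      then have \<gamma>L: "\<gamma> * L \<le> 1 / 32" using small unfolding \<gamma>_def by linarith
      have "\<gamma> * \<mu> \<le> \<gamma> * L" using \<open>\<gamma> > 0\<close> \<open>\<mu> \<le> L\<close> by simp
      then have "\<rho> \<le> 1" using \<gamma>L by (simp add: \<rho>_def)
      \<comment> \<open>Solves \<open>V (Suc t) = (1 - \<rho>) * V t + K\<close>: the fixed point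
        \<open>K / \<rho>\<close> plus a geometric term.\<close>
      define V where "V t = (1 - \<rho>) ^ t * Q + K / \<rho>" for t
      have "K \<ge> 0" using \<open>\<gamma> > 0\<close> by (simp add: K_def)
      have V_Suc: "(1 - \<rho>) * V t + K = V (Suc t)" for t
        using \<rho>T(2) by (simp add: V_def field_simps)
      define I where "I t = {(w, \<pi>). orders \<pi> \<and> (\<exists>S\<ge>0. prefix_bounded w \<pi> S \<and>
          f w - c + 7 / 2 * \<gamma> * L\<^sup>2 * (\<alpha> * S / m)\<^sup>2 \<le> V t)}" for t
      have "1 - real T * \<delta> \<le> ?P (I T)"
      proof (rule prob_cdgrab_ge)
        show "(w\<^sub>1, \<pi>\<^sub>1) \<in> I 0"
        proof -
          have \<pi>\<^sub>1: "orders \<pi>\<^sub>1" using assms(6) by (simp add: orders_def)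
          \<comment> \<open>An arbitrary initial order has prefix bound
            \<open>n * m * \<sigma>\<close>; its share of the potential fits into the summand
            \<open>\<sigma>\<^sup>2 / L\<close> of \<open>Q\<close>.\<close>
          have "7 / 2 * \<gamma> * L\<^sup>2 * (\<alpha> * (real n * real m * \<sigma>) / m)\<^sup>2 = 7 / 2 * (\<gamma> * L) ^ 3 * (\<sigma>\<^sup>2 / L)"
            using m_pos L_pos by (simp add: \<gamma>_def field_simps power2_eq_square power3_eq_cube)
          also have "\<dots> \<le> 7 / 2 * (1 / 32) ^ 3 * (\<sigma>\<^sup>2 / L)"
            using \<gamma>L \<open>\<gamma> > 0\<close> L_pos by (intro mult_right_mono mult_left_mono power_mono) auto
          also have "\<dots> \<le> 1 * (\<sigma>\<^sup>2 / L)" using L_pos by (intro mult_right_mono) (auto simp: power_divide)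
          finally have "f w\<^sub>1 - c + 7 / 2 * \<gamma> * L\<^sup>2 * (\<alpha> * (real n * real m * \<sigma>) / m)\<^sup>2 \<le> V 0"
            using \<open>K \<ge> 0\<close> \<rho>T(2) F\<^sub>1(1) by (simp add: V_def Q_def add_increasing2)
          then show ?thesis using \<pi>\<^sub>1 prefix_bounded_initial[OF \<pi>\<^sub>1] \<sigma>_pos
            unfolding I_def by (auto intro!: exI[of _ "real n * real m * \<sigma>"])
        qed
      next
        fix t w \<pi>
        assume "(w, \<pi>) \<in> I t"
        then obtain S where S: "orders \<pi>" "0 \<le> S" "prefix_bounded w \<pi> S"
          "f w - c + 7 / 2 * \<gamma> * L\<^sup>2 * (\<alpha> * S / m)\<^sup>2 \<le> V t" by (auto simp: I_def)
        let ?cs = "pair_diffs m n loss \<alpha> w \<pi>"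
        have "length ?cs = n div 2 * m"
          unfolding pair_diffs_def by (simp add: length_concat comp_def sum_list_triv)
        then have "length ?cs \<le> m * n" by (simp add: mult.commute[of m] mult_le_mono1)
        then have "1 - \<delta> \<le> measure_pmf.prob (balance_walk thr [] 0 ?cs) {ss. good_signs A ?cs ss}"
          using assms(8) unfolding balance_guarantee_def good_signs_def assms(18) by blast
        also have "\<dots> \<le> measure_pmf.prob (balance_walk thr [] 0 ?cs)
            {ss. (inner_iterate m loss \<alpha> w \<pi> n, reorder m n ss \<pi>) \<in> I (Suc t)}"
        proof (rule measure_pmf.finite_measure_mono, safe)
          fix ss
          assume "good_signs A ?cs ss"
          then obtain S' where S': "0 \<le> S'"
            "prefix_bounded (inner_iterate m loss \<alpha> w \<pi> n) (reorder m n ss \<pi>) S'"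
            "f (inner_iterate m loss \<alpha> w \<pi> n) - c + 7 / 2 * \<gamma> * L\<^sup>2 * (\<alpha> * S' / m)\<^sup>2
              \<le> (1 - \<rho>) * (f w - c + 7 / 2 * \<gamma> * L\<^sup>2 * (\<alpha> * S / m)\<^sup>2) + K"
            using lyapunov_step[OF S(1,3,2) _ \<open>\<alpha> > 0\<close> small \<open>\<mu> \<le> L\<close> assms(16)[of w]] \<open>A \<ge> 1\<close>
            unfolding f_def c_def \<gamma>_def \<rho>_def K_def B_def by auto
          have "(1 - \<rho>) * (f w - c + 7 / 2 * \<gamma> * L\<^sup>2 * (\<alpha> * S / m)\<^sup>2) + K \<le> (1 - \<rho>) * V t + K"
            using S(4) \<open>\<rho> \<le> 1\<close> by (intro add_right_mono mult_left_mono) auto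
          then show "(inner_iterate m loss \<alpha> w \<pi> n, reorder m n ss \<pi>) \<in> I (Suc t)"
            using S' orders_reorder[OF S(1)] unfolding I_def V_Suc by (auto intro!: exI[of _ S'])
        qed simp
        finally show "1 - \<delta> \<le> measure_pmf.prob (balance_walk thr [] 0 ?cs)
            {ss. (inner_iterate m loss \<alpha> w \<pi> n, reorder m n ss \<pi>) \<in> I (Suc t)}" .
      qed (use assms(7) \<open>\<delta> < 1\<close> in auto)
      also have "\<dots> \<le> ?P {(w, \<pi>). f w - c \<le> ?bound}"
      proof (rule measure_pmf.finite_measure_mono, safe)
        fix w \<pi>
        assume "(w, \<pi>) \<in> I T"
        then obtain S where "f w - c + 7 / 2 * \<gamma> * L\<^sup>2 * (\<alpha> * S / m)\<^sup>2 \<le> V T" by (auto simp: I_def)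
        moreover have "0 \<le> 7 / 2 * \<gamma> * L\<^sup>2 * (\<alpha> * S / m)\<^sup>2" using \<open>\<gamma> > 0\<close> by simp
        moreover have "V T \<le> ?bound"
        proof -
          have "(1 - \<rho>) ^ T \<le> exp (- \<rho>) ^ T"
            using \<open>\<rho> \<le> 1\<close> exp_ge_add_one_self[of "- \<rho>"] by (intro power_mono) auto
          also have "\<dots> = exp (- W)" using \<rho>T(1) by (simp add: mult.commute flip: exp_of_nat_mult)
          \<comment> \<open>The defining equation of the Lambert function turns exponential decay
            into the rate.\<close>
          also have "\<dots> = W / (P\<^sup>2 * C)"
            using W(1) unfolding W(2)[symmetric] by (simp add: exp_minus field_simps)
          finally have "(1 - \<rho>) ^ T * Q \<le> W / (P\<^sup>2 * C) * Q"
            using \<open>Q > 0\<close> by (intro mult_right_mono) auto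
          \<comment> \<open>The constant is 14 * 2 * 4 = 112: the factor 2 comes from dividing by
            \<open>\<rho>\<close>, the factor 4 from squaring the 2 in the learning rate.\<close>
          moreover have "K / \<rho> \<le> 1 / P\<^sup>2 * (112 * L\<^sup>2 * (\<zeta> + \<sigma>)\<^sup>2 * A\<^sup>2 * W\<^sup>2 / \<mu> ^ 3)"
          proof -
            have "B = 2 * W * A * \<sigma> / (P * \<mu>)"
              unfolding B_def assms(20) P_def by (simp add: field_simps)
            moreover have "K / \<rho> = 28 * L\<^sup>2 * B\<^sup>2 / \<mu>"
              using \<open>\<gamma> > 0\<close> assms(15) by (simp add: K_def \<rho>_def field_simps)
            ultimately have "K / \<rho> = 1 / P\<^sup>2 * (112 * L\<^sup>2 * \<sigma>\<^sup>2 * A\<^sup>2 * W\<^sup>2 / \<mu> ^ 3)"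
              by (simp add: power_mult_distrib power_divide power2_eq_square power3_eq_cube mult_ac)
            also have "\<dots> \<le> 1 / P\<^sup>2 * (112 * L\<^sup>2 * (\<zeta> + \<sigma>)\<^sup>2 * A\<^sup>2 * W\<^sup>2 / \<mu> ^ 3)"
              using assms(9,11,15) by (intro mult_left_mono divide_right_mono mult_right_mono power_mono) auto
            finally show ?thesis .
          qed
          ultimately show ?thesis unfolding V_def bound distrib_left by (simp add: mult_ac)
        qed
        ultimately show "f w - c \<le> ?bound" by linarith
      qed simp
      finally show ?thesis .
    qed
  qed
  moreover note cdgrab_bound_soft_bigo[OF F\<^sub>1(2) \<sigma>_pos assms(11) L_pos assms(15)]
  ultimately show ?thesis unfolding f_def c_def by blast
qed

end
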